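(* For every integer $n\ge 1$, the set $\{\rho_\sigma:\sigma\in\mathcal F_n\}$ forms a basis for $\widetilde H_n(\Delta(\operatorname{Rees}(\mathscr{C}_n,C_{n+1})))$ over $\mathbb Z$.
   Context: $\mathscr{C}_n$ is the face lattice of the $n$-dimensional cube (including the empty face $\hat 0$), of rank $n+1$, and $C_{n+1}$ is the chain on $n+1$ elements. The poset $\operatorname{Rees}(\mathscr{C}_n,C_{n+1})$ consists of a minimum $\hat 0$, a maximum $\hat 1$, and the pairs $(x,i)$ with $x\in\{0,1,*\}^n$ (a nonempty face of the cube, of dimension the number $\operatorname{st}(x)$ of stars) and $1\le i\le \operatorname{st}(x)+1$; the pairs are ordered by $(x,i)\le(y,j)$ iff $x\le y$ (i.e. $y$ is obtained from $x$ by changing some entries to $*$) and $0\le j-i\le \operatorname{st}(y)-\operatorname{st}(x)$. For a poset $P$ with $\hat 0,\hat 1$, $\Delta(P)$ is the order complex: the simplicial complex of chains in $P-\{\hat 0,\hat 1\}$. Reduced simplicial homology is taken with integer coefficients. $\mathcal F_n$ (falling double augmented barred signed permutations): words $\sigma=\sigma_0\sigma_1\cdots\sigma_{n+1}$ with $\sigma_0=0$, $\sigma_{n+1}=n+1$ (both unbarred), and for $1\le i\le n$, $\sigma_i\in\{a_i,-a_i,\overline{a_i},\overline{-a_i}\}$ where $a_1\cdots a_n$ is a permutation of $\{1,\dots,n\}$, such that for all $0\le i\le n$: if $\sigma_i$ is unbarred there is a descent at position $i$; if $\sigma_i$ is barred then either $\sigma_{i+1}$ is unbarred, or $\sigma_{i+1}$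 is barred and there is a descent at position $i$. Here a descent at position $i$ means $|\sigma_i|>|\sigma_{i+1}|$, where $|\sigma_j|$ is $\sigma_j$ with its bar (if any) removed and its sign preserved. For $\sigma\in\mathcal F_n$, $m_\sigma=(m_{\sigma,0}\prec m_{\sigma,1}\prec\cdots\prec m_{\sigma,n})$ is the following chain in $\operatorname{Rees}(\mathscr{C}_n,C_{n+1})-\{\hat 0,\hat 1\}$: $m_{\sigma,0}=(x,1)$, where $x_a=1$ if $a$ or $\overline{a}$ occurs in $\sigma_1\cdots\sigma_n$ and $x_a=0$ if $-a$ or $\overline{-a}$ occurs; and $m_{\sigma,i}$ is obtained from $m_{\sigma,i-1}$ by replacing the entry in coordinate $a_i$ by $*$ and increasing the second coordinate by $1$ if $\sigma_i$ is barred and by $0$ otherwise. For $\sigma\in\mathcal F_n$, the subposet $\mathscr C_\sigma$ of $\operatorname{Rees}(\mathscr{C}_n,C_{n+1})$ (with induced order) is defined recursively. Its rank $0$ elements are all $(x,1)$ with $x$ a vertex of the $n$-cube. For $1\le i\le n-1$ its rank $i$ elements are of the form $(x,j)$, one for each $i$-dimensional face $x$ of the $n$-cube, with $j$ given by: (i) if $\sigma_{i-1}$ and $\sigma_i$ are unbarred (and $\sigma_{i+1}$ arbitrary), then $j=k$, where $(y,k)$ is any rank $i-1$ element of $\mathscr C_\sigma$; (ii) if $\sigma_i$ and $\sigma_{i+1}$ are barred (and $\sigma_{i-1}$ arbitrary), then $j=k+1$, where $(y,k)$ is any rank $i-1$ element of $\mathscr C_\sigma$; (iii) if $\sigma_i$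 is barred and $\sigma_{i+1}$ is unbarred (and $\sigma_{i-1}$ arbitrary), then $j=k$, where $(y,k)$ is any rank $i-1$ element of $\mathscr C_\sigma$, except that for the face $x$ that is the first coordinate of $m_{\sigma,i}$ the element is $(x,k+1)$; (iv) if $\sigma_{i-1}$ is barred and $\sigma_i$ is unbarred (and $\sigma_{i+1}$ arbitrary), then $j=k+1$, where $(y,k)$ is any rank $i-1$ element of $\mathscr C_\sigma$ different from $m_{\sigma,i-1}$. Finally there are two rank $n$ elements $( *\cdots*,k)$ and $( *\cdots*,k+1)$, where $k$ is the second coordinate of any rank $n-1$ element of $\mathscr C_\sigma$. The order complex $\Delta(\mathscr C_\sigma)$ (all chains of $\mathscr C_\sigma$) is a triangulation of the $n$-sphere and a subcomplex of $\Delta(\operatorname{Rees}(\mathscr{C}_n,C_{n+1}))$; $\rho_\sigma$ denotes a fundamental cycle of it, i.e. a generator of $\widetilde H_n(\Delta(\mathscr C_\sigma);\mathbb Z)\cong\mathbb Z$, viewed in $\widetilde H_n(\Delta(\operatorname{Rees}(\mathscr{C}_n,C_{n+1}));\mathbb Z)$. *)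

theory Defs
  imports "HOL-Algebra.Free_Abelian_Groups"
begin

section \<open>Reduced simplicial homology of order complexes\<close>

text \<open>A poset is given by a carrier set and an order relation. A \<open>p\<close>-simplex of its order
  complex, that is a chain of \<open>p + 1\<close> elements, is represented by the list of its elements in
  increasing order.\<close>

definition simplices :: "'a set \<Rightarrow> ('a \<Rightarrow> 'a \<Rightarrow> bool) \<Rightarrow> nat \<Rightarrow> 'a list set" where
  "simplices A leq p =
     {xs. set xs \<subseteq> A \<and> sorted_wrt (\<lambda>x y. leq x y \<and> x \<noteq> y) xs \<and> length xs = Suc p}"

definition chain_group ::
    "'a set \<Rightarrow> ('a \<Rightarrow> 'a \<Rightarrow> bool) \<Rightarrow> nat \<Rightarrow> ('a list \<Rightarrow>\<^sub>0 int) monoid" where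
  "chain_group A leq p = free_Abelian_group (simplices A leq p)"

text \<open>The boundary of a one-element list is the empty list, i.e. the empty simplex; on
  0-chains the boundary map is therefore the augmentation, which is what makes the homology
  below reduced.\<close>

definition boundary :: "('a list \<Rightarrow>\<^sub>0 int) \<Rightarrow> ('a list \<Rightarrow>\<^sub>0 int)" where
  "boundary =
     frag_extend (\<lambda>xs. \<Sum>k<length xs. frag_cmul ((-1) ^ k) (frag_of (take k xs @ drop (Suc k) xs)))"

definition cycles :: "'a set \<Rightarrow> ('a \<Rightarrow> 'a \<Rightarrow> bool) \<Rightarrow> nat \<Rightarrow> ('a list \<Rightarrow>\<^sub>0 int) set" where
  "cycles A leq p = {c \<in> carrier (chain_group A leq p). boundary c = 0}"

definition boundaries :: "'a set \<Rightarrow> ('a \<Rightarrow> 'a \<Rightarrow> bool) \<Rightarrow> nat \<Rightarrow> ('a list \<Rightarrow>\<^sub>0 int) set" where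
  "boundaries A leq p = boundary ` carrier (chain_group A leq (Suc p))"

definition cycle_group ::
    "'a set \<Rightarrow> ('a \<Rightarrow> 'a \<Rightarrow> bool) \<Rightarrow> nat \<Rightarrow> ('a list \<Rightarrow>\<^sub>0 int) monoid" where
  "cycle_group A leq p = subgroup_generated (chain_group A leq p) (cycles A leq p)"

definition reduced_homology ::
    "'a set \<Rightarrow> ('a \<Rightarrow> 'a \<Rightarrow> bool) \<Rightarrow> nat \<Rightarrow> ('a list \<Rightarrow>\<^sub>0 int) set monoid" where
  "reduced_homology A leq p = cycle_group A leq p Mod boundaries A leq p"

definition homology_class ::
    "'a set \<Rightarrow> ('a \<Rightarrow> 'a \<Rightarrow> bool) \<Rightarrow> nat \<Rightarrow> ('a list \<Rightarrow>\<^sub>0 int) \<Rightarrow> ('a list \<Rightarrow>\<^sub>0 int) set" where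
  "homology_class A leq p z = boundaries A leq p #>\<^bsub>cycle_group A leq p\<^esub> z"

text \<open>A fundamental cycle of an order complex that triangulates a \<open>p\<close>-sphere: a cycle whose
  class generates the (infinite cyclic) reduced homology group in degree \<open>p\<close>. It is unique up
  to sign.\<close>

definition fundamental_cycle ::
    "'a set \<Rightarrow> ('a \<Rightarrow> 'a \<Rightarrow> bool) \<Rightarrow> nat \<Rightarrow> ('a list \<Rightarrow>\<^sub>0 int) \<Rightarrow> bool" where
  "fundamental_cycle A leq p z \<longleftrightarrow>
     z \<in> cycles A leq p \<and>
     carrier (reduced_homology A leq p) = generate (reduced_homology A leq p) {homology_class A leq p z}"


section \<open>Bases of abelian groups\<close>

text \<open>Abelian groups are written multiplicatively: the integral linear combination of the
  \<open>b i\<close> with coefficients \<open>c i\<close> (of finite support) is the product of the powers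
  \<open>b i [^] c i\<close>.\<close>

definition int_combination :: "('g, 'm) monoid_scheme \<Rightarrow> ('i \<Rightarrow> 'g) \<Rightarrow> ('i \<Rightarrow>\<^sub>0 int) \<Rightarrow> 'g" where
  "int_combination G b c =
     finprod G (\<lambda>i. b i [^]\<^bsub>G\<^esub> Poly_Mapping.lookup c i) (Poly_Mapping.keys c)"

text \<open>Being a basis is a property of the family \<open>b\<close> indexed by \<open>I\<close>; it entails that \<open>b\<close> is
  injective on \<open>I\<close>.\<close>

definition int_basis :: "('g, 'm) monoid_scheme \<Rightarrow> 'i set \<Rightarrow> ('i \<Rightarrow> 'g) \<Rightarrow> bool" where
  "int_basis G I b \<longleftrightarrow>
     b ` I \<subseteq> carrier G \<and>
     (\<forall>x \<in> carrier G. \<exists>c. Poly_Mapping.keys c \<subseteq> I \<and> x = int_combination G b c) \<and>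
     (\<forall>c. Poly_Mapping.keys c \<subseteq> I \<and> int_combination G b c = \<one>\<^bsub>G\<^esub> \<longrightarrow> c = 0)"


section \<open>The Rees product of the cube face lattice with a chain\<close>

datatype coord = Zero_coord | One_coord | Star

text \<open>A nonempty face of the \<open>n\<close>-cube is a list of length \<open>n\<close>; coordinate \<open>a\<close>, for
  \<open>1 \<le> a \<le> n\<close>, is the list entry with index \<open>a - 1\<close>.\<close>

type_synonym face = "coord list"

definition st :: "face \<Rightarrow> nat" where
  "st x = count_list x Star"

definition face_le :: "face \<Rightarrow> face \<Rightarrow> bool" where
  "face_le x y \<longleftrightarrow> list_all2 (\<lambda>a b. b = a \<or> b = Star) x y"

datatype rees = Bot | Elem "face \<times> nat" | Top

fun rees_le :: "rees \<Rightarrow> rees \<Rightarrow> bool" where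
  "rees_le Bot _ = True"
| "rees_le (Elem _) Bot = False"
| "rees_le (Elem (x, i)) (Elem (y, j)) =
     (face_le x y \<and> 0 \<le> int j - int i \<and> int j - int i \<le> int (st y) - int (st x))"
| "rees_le (Elem _) Top = True"
| "rees_le Top u = (u = Top)"

definition rees_poset :: "nat \<Rightarrow> rees set" where
  "rees_poset n = {Bot, Top} \<union> {Elem (x, i) |x i. length x = n \<and> 1 \<le> i \<and> i \<le> st x + 1}"


section \<open>Falling double augmented barred signed permutations\<close>

text \<open>A letter is a signed integer together with a flag telling whether it is barred. The
  value \<open>fst\<close> of a letter is the letter with its bar removed and its sign preserved, and descents
  compare these signed values.\<close>

type_synonym letter = "int \<times> bool"

abbreviation barred :: "letter list \<Rightarrow> nat \<Rightarrow> bool" where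
  "barred \<sigma> i \<equiv> snd (\<sigma> ! i)"

definition descent :: "letter list \<Rightarrow> nat \<Rightarrow> bool" where
  "descent \<sigma> i \<longleftrightarrow> fst (\<sigma> ! i) > fst (\<sigma> ! Suc i)"

definition letter_index :: "letter list \<Rightarrow> nat \<Rightarrow> nat" where
  "letter_index \<sigma> i = nat \<bar>fst (\<sigma> ! i)\<bar>"

definition falling_words :: "nat \<Rightarrow> letter list set" where
  "falling_words n =
     {\<sigma>. length \<sigma> = n + 2 \<and>
         \<sigma> ! 0 = (0, False) \<and> \<sigma> ! (n + 1) = (int (n + 1), False) \<and>
         bij_betw (letter_index \<sigma>) {1..n} {1..n} \<and>
         (\<forall>i \<le> n. (\<not> barred \<sigma> i \<longrightarrow> descent \<sigma> i) \<and>
                  (barred \<sigma> i \<longrightarrow>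
                     \<not> barred \<sigma> (Suc i) \<or> barred \<sigma> (Suc i) \<and> descent \<sigma> i))}"

primrec m_chain :: "nat \<Rightarrow> letter list \<Rightarrow> nat \<Rightarrow> face \<times> nat" where
  "m_chain n \<sigma> 0 =
     (map (\<lambda>a. if \<exists>i \<in> {1..n}. fst (\<sigma> ! i) = int a then One_coord else Zero_coord) [1..<Suc n], 1)"
| "m_chain n \<sigma> (Suc i) =
     ((fst (m_chain n \<sigma> i)) [letter_index \<sigma> (Suc i) - 1 := Star],
      snd (m_chain n \<sigma> i) + (if barred \<sigma> (Suc i) then 1 else 0))"


section \<open>The sphere attached to a falling word\<close>

text \<open>\<open>sphere_rank n \<sigma> i (x, j)\<close> says that \<open>(x, j)\<close> is a rank \<open>i\<close> element of
  \<open>\<C>\<^sub>\<sigma>\<close>. For \<open>\<sigma>\<close> in \<open>falling_words n\<close> the choice of \<open>(y, k)\<close> in the previous rank is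
  immaterial: whenever the rule does not exclude one element of that rank, all its elements have
  the same second coordinate, and otherwise all but the excluded one do.\<close>

inductive sphere_rank :: "nat \<Rightarrow> letter list \<Rightarrow> nat \<Rightarrow> face \<times> nat \<Rightarrow> bool"
  for n :: nat and \<sigma> :: "letter list" where
  vertex:
    "\<lbrakk>length x = n; st x = 0\<rbrakk> \<Longrightarrow> sphere_rank n \<sigma> 0 (x, 1)"
| unbarred_unbarred:
    "\<lbrakk>1 \<le> i; i \<le> n - 1; \<not> barred \<sigma> (i - 1); \<not> barred \<sigma> i;
      sphere_rank n \<sigma> (i - 1) (y, k); length x = n; st x = i\<rbrakk>
     \<Longrightarrow> sphere_rank n \<sigma> i (x, k)"
| barred_barred:
    "\<lbrakk>1 \<le> i; i \<le> n - 1; barred \<sigma> i; barred \<sigma> (i + 1);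
      sphere_rank n \<sigma> (i - 1) (y, k); length x = n; st x = i\<rbrakk>
     \<Longrightarrow> sphere_rank n \<sigma> i (x, k + 1)"
| barred_unbarred:
    "\<lbrakk>1 \<le> i; i \<le> n - 1; barred \<sigma> i; \<not> barred \<sigma> (i + 1);
      sphere_rank n \<sigma> (i - 1) (y, k); length x = n; st x = i\<rbrakk>
     \<Longrightarrow> sphere_rank n \<sigma> i (x, if x = fst (m_chain n \<sigma> i) then k + 1 else k)"
| unbarred_after_barred:
    "\<lbrakk>1 \<le> i; i \<le> n - 1; barred \<sigma> (i - 1); \<not> barred \<sigma> i;
      sphere_rank n \<sigma> (i - 1) (y, k); (y, k) \<noteq> m_chain n \<sigma> (i - 1); length x = n; st x = i\<rbrakk>
     \<Longrightarrow> sphere_rank n \<sigma> i (x, k + 1)"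
| top_lower:
    "\<lbrakk>1 \<le> n; sphere_rank n \<sigma> (n - 1) (y, k)\<rbrakk> \<Longrightarrow> sphere_rank n \<sigma> n (replicate n Star, k)"
| top_upper:
    "\<lbrakk>1 \<le> n; sphere_rank n \<sigma> (n - 1) (y, k)\<rbrakk> \<Longrightarrow> sphere_rank n \<sigma> n (replicate n Star, k + 1)"

definition sphere :: "nat \<Rightarrow> letter list \<Rightarrow> rees set" where
  "sphere n \<sigma> = {Elem e |e. \<exists>i \<le> n. sphere_rank n \<sigma> i e}"

end

theory Submission
  imports Defs
begin

text \<open>The Rees product without its two bounds is graded with ranks \<open>0, \<dots>, n\<close>. There are
  no boundaries in degree \<open>n\<close>, so the homology group is the group of \<open>n\<close>-cycles. A chain of dimension
  \<open>n\<close> is a cycle iff its coefficients satisfy equations without signs: for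
  every maximal chain and every rank \<open>k\<close>, the coefficients of all the maximal chains that differ from
  it at most at rank \<open>k\<close> add up to zero (\<open>cycles_iff\<close>).

  Maximal chains are encoded by words like those in \<open>falling_words\<close>, but without descent condition:
  the letters list the coordinates in the order in which they become stars, the signs determine the
  starting vertex, and a bar marks a step at which the second coordinate grows. Write \<open>m \<sigma>\<close> for the
  chain of \<open>\<sigma>\<close>. The theorem follows from three facts about the values of cycles at the chains \<open>m \<tau>\<close>
  with \<open>\<tau>\<close> falling: they say that the matrix of the values of the \<open>\<rho> \<sigma>\<close> at the \<open>m \<tau>\<close> is
  triangular with diagonal entries \<open>\<plusminus>1\<close>, and that these values determine a cycle
  (\<open>int_basis_if_unitriangular\<close>).

  \<^item> A cycle that vanishes at all \<open>m \<tau>\<close> is zero (\<open>cycle_zero_if_zero_on_falling_chains\<close>). Let the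
    potential of \<open>(x, j)\<close> be \<open>j\<close> minus the sum of \<open>\<plusminus>a\<close> over the coordinates \<open>a\<close> of \<open>x\<close> that are no
    stars, with sign \<open>+\<close> for the entry 1 and \<open>-\<close> for the entry 0. Where a word violates the
    falling condition at position \<open>i\<close>, the element of rank \<open>i\<close> of its chain has strictly smaller
    potential than every other element that fits between its neighbours. Hence among the chains in
    the support of a nonzero cycle one of largest total potential is falling: otherwise it would be
    the only chain of the support in one of the equations above. The total potential does the work of
    a shelling order.
  \<^item> The value of \<open>\<rho> \<sigma>\<close> at \<open>m \<sigma>\<close> is \<open>\<plusminus>1\<close> (\<open>fundamental_cycle_unit\<close>). The sphere of \<open>\<sigma>\<close> is the
    poset of nonempty faces of the cube with its top doubled. Products of cellular incidence
    numbers of the cube, with opposite signs for the two tops, are the coefficients of a cycle with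
    value \<open>\<plusminus>1\<close> at every maximal chain of the sphere; that cycle is an integer multiple of \<open>\<rho> \<sigma>\<close>.
  \<^item> If \<open>m \<tau>\<close> lies in the sphere of \<open>\<sigma>\<close>, then for each \<open>i\<close> at most as many of the first \<open>i\<close> letters
    are barred in \<open>\<tau>\<close> as in \<open>\<sigma>\<close>, and if these numbers agree for all \<open>i\<close>, then \<open>\<tau> = \<sigma>\<close>
    (\<open>falling_chain_in_sphere\<close>). In the case of equality the two chains share their faces at the
    ranks where a barred letter is followed by an unbarred one, and between two such ranks both words
    are decreasing, so the letters there are determined by their set.\<close>


section \<open>Top-degree homology and bases\<close>

abbreviation keys :: "('a \<Rightarrow>\<^sub>0 int) \<Rightarrow> 'a set" where
  "keys \<equiv> Poly_Mapping.keys"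

abbreviation lookup :: "('a \<Rightarrow>\<^sub>0 int) \<Rightarrow> 'a \<Rightarrow> int" where
  "lookup \<equiv> Poly_Mapping.lookup"

lemma subgroup_cycles: "subgroup (cycles A leq p) (chain_group A leq p)"
proof -
  show ?thesis
    unfolding subgroup_def cycles_def chain_group_def boundary_def
    using keys_add by (fastforce simp: frag_extend_add frag_extend_minus)
qed

lemma
  carrier_cycle_group: "carrier (cycle_group A leq p) = cycles A leq p" and
  mult_cycle_group: "x \<otimes>\<^bsub>cycle_group A leq p\<^esub> y = x + y" and
  one_cycle_group: "\<one>\<^bsub>cycle_group A leq p\<^esub> = 0"
  using subgroup.carrier_subgroup_generated_subgroup[OF subgroup_cycles]
  by (auto simp: cycle_group_def chain_group_def)

lemma comm_group_cycle_group: "comm_group (cycle_group A leq p)"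
  unfolding cycle_group_def chain_group_def
  by (intro group.abelian_subgroup_generated abelian_free_Abelian_group) simp

lemma int_pow_cycle_group:
  assumes "z \<in> cycles A leq p"
  shows "z [^]\<^bsub>cycle_group A leq p\<^esub> (k::int) = frag_cmul k z"
proof -
  have "z \<in> carrier (subgroup_generated (chain_group A leq p) (cycles A leq p))"
    using assms subgroup.carrier_subgroup_generated_subgroup[OF subgroup_cycles] by blast
  then have "z [^]\<^bsub>cycle_group A leq p\<^esub> k = z [^]\<^bsub>chain_group A leq p\<^esub> k"
    unfolding cycle_group_def
    by (metis chain_group_def group.int_pow_subgroup_generated group_free_Abelian_group)
  then show ?thesis
    using assms by (simp add: cycles_def chain_group_def)
qed

text \<open>Where there are no boundaries, homology is the cycle group with every cycle \<open>z\<close> replaced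
  by the coset \<open>{z}\<close>, and \<open>z \<mapsto> {z}\<close> is an isomorphism.\<close>

locale no_boundaries =
  fixes A :: "'a set" and leq :: "'a \<Rightarrow> 'a \<Rightarrow> bool" and p :: nat
  assumes boundaries_zero: "boundaries A leq p = {0}"
begin

abbreviation "Z \<equiv> cycle_group A leq p"
abbreviation "H \<equiv> reduced_homology A leq p"

lemma homology_class_eq: "homology_class A leq p z = {z}"
  by (simp add: homology_class_def boundaries_zero r_coset_def mult_cycle_group)

lemma carrier_reduced_homology: "carrier H = (\<lambda>z. {z}) ` cycles A leq p"
  by (auto simp: reduced_homology_def FactGroup_def RCOSETS_def boundaries_zero r_coset_def
      mult_cycle_group carrier_cycle_group)

lemma mult_reduced_homology: "{x} \<otimes>\<^bsub>H\<^esub> {y} = {x + y}"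
  by (simp add: reduced_homology_def FactGroup_def set_mult_def mult_cycle_group)

lemma one_reduced_homology: "\<one>\<^bsub>H\<^esub> = {0}"
  by (simp add: reduced_homology_def FactGroup_def boundaries_zero)

lemma comm_group_reduced_homology: "comm_group H"
proof -
  have "subgroup {0} Z"
    using group.triv_subgroup[of Z] comm_group_cycle_group comm_group.axioms(2)
    by (metis one_cycle_group)
  then show ?thesis
    unfolding reduced_homology_def boundaries_zero
    using comm_group.abelian_FactGroup[OF comm_group_cycle_group] by blast
qed

sublocale homology: comm_group H
  by (rule comm_group_reduced_homology)

sublocale to_homology: group_hom Z H "\<lambda>z. {z}"
  by (intro group_hom.intro group_hom_axioms.intro homI)
    (auto simp: carrier_reduced_homology carrier_cycle_group mult_reduced_homology mult_cycle_group
      comm_group.axioms(2)[OF comm_group_cycle_group] homology.is_group)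

lemma int_pow_reduced_homology:
  assumes "z \<in> cycles A leq p"
  shows "{z} [^]\<^bsub>H\<^esub> (k::int) = {frag_cmul k z}"
  using to_homology.hom_int_pow[of z k] assms by (simp add: carrier_cycle_group int_pow_cycle_group)

text \<open>Homology is cyclic by hypothesis, and it is the cycle group here: so the integer multiples of
  \<open>w\<close> are all the cycles.\<close>

lemma fundamental_cycle_multiple:
  assumes "fundamental_cycle A leq p w" and z: "z \<in> cycles A leq p"
  obtains k where "z = frag_cmul k w"
proof -
  have w: "w \<in> cycles A leq p" and gen: "carrier H = generate H {{w}}"
    using assms by (auto simp: fundamental_cycle_def homology_class_eq)
  have "{z} \<in> generate H {{w}}"
    using z gen carrier_reduced_homology by blast
  then show thesis
    using homology.generate_pow[of "{w}"] w that
    by (auto simp: carrier_reduced_homology int_pow_reduced_homology)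
qed

lemma cycles_add: "\<lbrakk>x \<in> cycles A leq p; y \<in> cycles A leq p\<rbrakk> \<Longrightarrow> x + y \<in> cycles A leq p"
  using subgroup.m_closed[OF subgroup_cycles, of x A leq p y] by (simp add: chain_group_def)

lemma cycles_minus: "x \<in> cycles A leq p \<Longrightarrow> - x \<in> cycles A leq p"
  using subgroup.m_inv_closed[OF subgroup_cycles, of x A leq p] 
  by (simp add: chain_group_def cycles_def)

lemma cycles_cmul: "x \<in> cycles A leq p \<Longrightarrow> frag_cmul k x \<in> cycles A leq p"
  using int_pow_cycle_group[of x A leq p k] group.int_pow_closed[of Z x k]
    comm_group.axioms(2)[OF comm_group_cycle_group] by (metis carrier_cycle_group)

lemma cycles_sum:
  assumes "\<And>i. i \<in> F \<Longrightarrow> w i \<in> cycles A leq p"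
  shows "(\<Sum>i\<in>F. frag_cmul (k i) (w i)) \<in> cycles A leq p"
  using assms
proof (induction F rule: infinite_finite_induct)
  case (insert i F)
  then show ?case by (simp add: cycles_add cycles_cmul)
qed (use subgroup.one_closed[OF subgroup_cycles, of A leq p] in \<open>simp_all add: chain_group_def\<close>)

lemma int_combination_reduced_homology:
  assumes "\<And>i. i \<in> keys c \<Longrightarrow> w i \<in> cycles A leq p"
  shows "int_combination H (\<lambda>i. {w i}) c = {\<Sum>i\<in>keys c. frag_cmul (lookup c i) (w i)}"
proof -
  have "finprod H (\<lambda>i. {w i} [^]\<^bsub>H\<^esub> lookup c i) F = {\<Sum>i\<in>F. frag_cmul (lookup c i) (w i)}"
    if "finite F" "\<And>i. i \<in> F \<Longrightarrow> w i \<in> cycles A leq p" for F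
    using that
  proof (induction F rule: finite_induct)
    case empty
    then show ?case by (simp add: one_reduced_homology)
  next
    case (insert i F)
    then show ?case
      by (subst homology.finprod_insert)
        (auto simp: carrier_reduced_homology int_pow_reduced_homology mult_reduced_homology
          cycles_cmul)
  qed
  then show ?thesis
    using assms by (simp add: int_combination_def)
qed

text \<open>Unitriangularity. The evaluations of the cycles \<open>w i\<close> at the simplices \<open>m j\<close> form a matrix
  with units on the diagonal that is triangular for the weight \<open>W\<close>; hence it is invertible over
  the integers. Since a cycle is determined by its values at the \<open>m j\<close>, evaluation is an
  isomorphism from the cycles to the integer vectors indexed by \<open>I\<close>, and the \<open>w i\<close> are a basis.\<close>

lemma int_basis_if_unitriangular:
  fixes W :: "'i \<Rightarrow> nat"
  assumes fin: "finite I"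
    and w: "\<And>i. i \<in> I \<Longrightarrow> w i \<in> cycles A leq p"
    and unit: "\<And>i. i \<in> I \<Longrightarrow> \<bar>lookup (w i) (m i)\<bar> = 1"
    and triangular: "\<And>i j. \<lbrakk>i \<in> I; j \<in> I; lookup (w i) (m j) \<noteq> 0\<rbrakk> \<Longrightarrow> i = j \<or> W j < W i"
    and determined: "\<And>z. \<lbrakk>z \<in> cycles A leq p; \<And>j. j \<in> I \<Longrightarrow> lookup z (m j) = 0\<rbrakk> \<Longrightarrow> z = 0"
  shows "int_basis H I (\<lambda>i. homology_class A leq p (w i))"
proof -
  have lookup_comb: "lookup (\<Sum>i\<in>F. frag_cmul (k i) (w i)) x = (\<Sum>i\<in>F. k i * lookup (w i) x)"
    for k and F and x by (simp add: lookup_sum)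
  \<comment> \<open>clear the values at the simplices of weight at least \<open>b\<close>, from the largest weight down\<close>
  have span: "\<exists>k. \<forall>j\<in>I. lookup z (m j) = (\<Sum>i\<in>I. k i * lookup (w i) (m j))"
    if "z \<in> cycles A leq p" for z
  proof -
    define N where "N = Suc (Max (insert 0 (W ` I)))"
    have N: "W i < N" if "i \<in> I" for i
      using that fin unfolding N_def by (simp add: less_Suc_eq_le)
    have "\<exists>k. \<forall>j\<in>I. b \<le> W j \<longrightarrow> lookup z (m j) = (\<Sum>i\<in>I. k i * lookup (w i) (m j))"
      if "b \<le> N" for b
      using that
    proof (induction b rule: inc_induct)
      case base
      then show ?case using N by (meson leD)
    next
      case (step b)
      then obtain k where
        k: "\<forall>j\<in>I. Suc b \<le> W j \<longrightarrow> lookup z (m j) = (\<Sum>i\<in>I. k i * lookup (w i) (m j))" by blast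
      define d where "d j = lookup z (m j) - (\<Sum>i\<in>I. k i * lookup (w i) (m j))" for j
      define l where "l i = (if W i = b then d i * lookup (w i) (m i) else 0)" for i
      have "lookup z (m j) = (\<Sum>i\<in>I. (k i + l i) * lookup (w i) (m j))"
        if j: "j \<in> I" "b \<le> W j" for j
      proof -
        have sq: "lookup (w j) (m j) * lookup (w j) (m j) = 1"
          using unit[OF j(1)] by (metis abs_mult_self_eq mult_1)
        have "l i * lookup (w i) (m j) = (if i = j then d j else 0)" if "i \<in> I" for i
          using triangular[of i j] that j sq k by (auto simp: l_def d_def mult.assoc)
        then have "(\<Sum>i\<in>I. l i * lookup (w i) (m j)) = d j"
          using j fin by simp
        then show ?thesis
          by (simp add: d_def distrib_right sum.distrib)
      qed
      then show ?case by (intro exI[of _ "\<lambda>i. k i + l i"]) blast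
    qed
    from this[of 0] show ?thesis by simp
  qed
  \<comment> \<open>in a relation, a term of largest weight is the only one that does not vanish at its simplex\<close>
  have indep: "k i = 0"
    if zero: "(\<Sum>i\<in>I. frag_cmul (k i) (w i)) = 0" and i: "i \<in> I" for k i
  proof (rule ccontr)
    assume "k i \<noteq> 0"
    then have "\<exists>i. i \<in> I \<and> k i \<noteq> 0" using i by blast
    then have S: "finite (W ` {i \<in> I. k i \<noteq> 0})" "W ` {i \<in> I. k i \<noteq> 0} \<noteq> {}"
      using fin by auto
    obtain j where j: "j \<in> I" "k j \<noteq> 0" and "W j = Max (W ` {i \<in> I. k i \<noteq> 0})"
      using Max_in[OF S] by auto
    then have greatest: "W i \<le> W j" if "i \<in> I" "k i \<noteq> 0" for i
      using Max_ge[OF S(1)] that by auto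
    have "k i * lookup (w i) (m j) = (if i = j then k j * lookup (w j) (m j) else 0)"
      if "i \<in> I" for i
    proof (cases "k i = 0 \<or> lookup (w i) (m j) = 0")
      case True
      then show ?thesis using j unit[OF j(1)] by auto
    next
      case False
      then have "i = j"
        using triangular[of i j] greatest[of i] that j by fastforce
      then show ?thesis by simp
    qed
    then have "(\<Sum>i\<in>I. k i * lookup (w i) (m j)) =
        (\<Sum>i\<in>I. if i = j then k j * lookup (w j) (m j) else 0)"
      by (rule sum.cong[OF refl])
    also have "\<dots> = k j * lookup (w j) (m j)"
      using j fin by simp
    finally have "(\<Sum>i\<in>I. k i * lookup (w i) (m j)) = k j * lookup (w j) (m j)" .
    moreover have "(\<Sum>i\<in>I. k i * lookup (w i) (m j)) = 0"
      using zero lookup_comb[of k I "m j"] by simp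
    ultimately have "k j * lookup (w j) (m j) = 0" by (rule trans[OF sym])
    then have "lookup (w j) (m j) = 0" using j(2) by simp
    then show False using unit[OF j(1)] by simp
  qed
  show ?thesis
    unfolding int_basis_def homology_class_eq
  proof (intro conjI ballI allI impI)
    show "(\<lambda>i. {w i}) ` I \<subseteq> carrier H"
      using w carrier_reduced_homology by auto
  next
    fix x assume "x \<in> carrier H"
    then obtain z where z: "z \<in> cycles A leq p" "x = {z}"
      using carrier_reduced_homology by auto
    obtain k where k: "\<forall>j\<in>I. lookup z (m j) = (\<Sum>i\<in>I. k i * lookup (w i) (m j))"
      using span z by blast
    define c where "c = Abs_poly_mapping (\<lambda>i. if i \<in> I then k i else 0)"
    have c: "lookup c i = (if i \<in> I then k i else 0)" for i
      unfolding c_def using fin by (subst lookup_Abs_poly_mapping) auto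
    have keys: "keys c \<subseteq> I"
      using c by (auto simp: in_keys_iff split: if_splits)
    have eq: "(\<Sum>i\<in>keys c. frag_cmul (lookup c i) (w i)) = (\<Sum>i\<in>I. frag_cmul (k i) (w i))"
      by (rule sum.mono_neutral_cong_left) (use fin keys c in \<open>auto simp: in_keys_iff\<close>)
    have "z + - (\<Sum>i\<in>I. frag_cmul (k i) (w i)) = 0"
    proof (rule determined)
      show "z + - (\<Sum>i\<in>I. frag_cmul (k i) (w i)) \<in> cycles A leq p"
        using z w by (intro cycles_add cycles_minus cycles_sum) auto
      show "lookup (z + - (\<Sum>i\<in>I. frag_cmul (k i) (w i))) (m j) = 0" if "j \<in> I" for j
        using k that by (simp add: lookup_minus lookup_comb)
    qed
    then have "z = (\<Sum>i\<in>I. frag_cmul (k i) (w i))" by simp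
    then show "\<exists>c. keys c \<subseteq> I \<and> x = int_combination H (\<lambda>i. {w i}) c"
      using keys w z eq by (intro exI[of _ c]) (subst int_combination_reduced_homology, auto)
  next
    fix c assume c: "keys c \<subseteq> I \<and> int_combination H (\<lambda>i. {w i}) c = \<one>\<^bsub>H\<^esub>"
    then have "(\<Sum>i\<in>keys c. frag_cmul (lookup c i) (w i)) = 0"
      using w one_reduced_homology int_combination_reduced_homology[of c w] by auto
    moreover have "(\<Sum>i\<in>keys c. frag_cmul (lookup c i) (w i)) = (\<Sum>i\<in>I. frag_cmul (lookup c i) (w i))"
      by (rule sum.mono_neutral_cong_left) (use fin c in \<open>auto simp: in_keys_iff\<close>)
    ultimately have "lookup c i = 0" for i
      using indep[of "lookup c" i] c by (cases "i \<in> I") (auto simp: in_keys_iff)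
    then show "c = 0" by (simp add: poly_mapping_eqI)
  qed
qed

end

section \<open>Cycles on maximal chains of graded posets\<close>

definition omit :: "nat \<Rightarrow> 'a list \<Rightarrow> 'a list" where
  "omit k xs = take k xs @ drop (Suc k) xs"

lemma nth_omit:
  "\<lbrakk>k < length xs; i < length xs - 1\<rbrakk> \<Longrightarrow> omit k xs ! i = (if i < k then xs ! i else xs ! Suc i)"
  by (simp add: omit_def nth_append min_def)

lemma omit_list_update [simp]: "omit k (xs[k := e]) = omit k xs"
  by (simp add: omit_def)

lemma eq_if_omit_eq:
  assumes "omit k xs = omit k ys" "k < length xs" "length ys = length xs"
  shows "ys = xs[k := ys ! k]"
proof -
  have "take k xs = take k ys" "drop (Suc k) xs = drop (Suc k) ys"
    using assms by (simp_all add: omit_def append_eq_append_conv)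
  then show ?thesis
    using assms by (metis id_take_nth_drop upd_conv_take_nth_drop)
qed

lemma simplices_nth:
  assumes "xs \<in> simplices A leq p"
  shows "k \<le> p \<Longrightarrow> xs ! k \<in> A"
    and "k < p \<Longrightarrow> leq (xs ! k) (xs ! Suc k) \<and> xs ! k \<noteq> xs ! Suc k"
  using assms by (auto simp: simplices_def sorted_wrt_iff_nth_less)

lemma lookup_boundary:
  "lookup (boundary c) ys =
    (\<Sum>xs\<in>keys c. \<Sum>k<length xs. if omit k xs = ys then (-1) ^ k * lookup c xs else 0)"
  unfolding boundary_def frag_extend_def omit_def
  by (simp add: lookup_sum sum_distrib_left if_distrib mult.commute
      eq_commute[of ys] cong: if_cong)

text \<open>The ranks of the elements of a maximal chain are \<open>0, \<dots>, n\<close>.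
  Therefore a codimension one face knows which rank it omits, all its cofaces
  enter its boundary coefficient with the same sign, and being a cycle is a family of conditions
  without signs.\<close>

locale graded =
  fixes A :: "'a set" and leq :: "'a \<Rightarrow> 'a \<Rightarrow> bool" and rank :: "'a \<Rightarrow> nat" and n :: nat
  assumes finite_carrier: "finite A"
    and rank_less: "\<lbrakk>x \<in> A; y \<in> A; leq x y; x \<noteq> y\<rbrakk> \<Longrightarrow> rank x < rank y"
    and rank_le: "x \<in> A \<Longrightarrow> rank x \<le> n"
begin

lemma rank_nth_ge:
  assumes "xs \<in> simplices A leq p" "k \<le> p"
  shows "k \<le> rank (xs ! k)"
  using assms(2)
proof (induction k)
  case (Suc k)
  have "leq (xs ! k) (xs ! Suc k) \<and> xs ! k \<noteq> xs ! Suc k"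
    using assms(1) Suc.prems by (simp add: simplices_nth)
  moreover have "xs ! k \<in> A" "xs ! Suc k \<in> A"
    using assms(1) Suc.prems by (simp_all add: simplices_nth)
  ultimately have "rank (xs ! k) < rank (xs ! Suc k)"
    using rank_less by blast
  then show ?case using Suc by simp
qed simp

lemma simplices_empty: "n < p \<Longrightarrow> simplices A leq p = {}"
proof (rule ccontr)
  assume "n < p" "simplices A leq p \<noteq> {}"
  then obtain xs where xs: "xs \<in> simplices A leq p" by blast
  then have "xs ! p \<in> A" by (auto simp: simplices_def)
  then show False
    using rank_nth_ge[OF xs, of p] rank_le \<open>n < p\<close> by fastforce
qed

lemma rank_nth:
  assumes xs: "xs \<in> simplices A leq n" and "k \<le> n"
  shows "rank (xs ! k) = k"
  using \<open>k \<le> n\<close>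
proof (induction k rule: inc_induct)
  case base
  have "xs ! n \<in> A" using xs by (auto simp: simplices_def)
  then show ?case using rank_nth_ge[OF xs, of n] rank_le by fastforce
next
  case (step k)
  have "leq (xs ! k) (xs ! Suc k) \<and> xs ! k \<noteq> xs ! Suc k"
    using xs step.hyps by (simp add: simplices_nth)
  moreover have "xs ! k \<in> A" "xs ! Suc k \<in> A"
    using xs step.hyps by (simp_all add: simplices_nth)
  ultimately have "rank (xs ! k) < rank (xs ! Suc k)"
    using rank_less by blast
  then show ?case using step rank_nth_ge[OF xs, of k] by simp
qed

sublocale no_boundaries A leq n
  by unfold_locales (auto simp: boundaries_def chain_group_def simplices_empty boundary_def)

lemma omit_eq_iff:
  assumes "xs \<in> simplices A leq n" "ys \<in> simplices A leq n" "k \<le> n" "l \<le> n"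
  shows "omit l ys = omit k xs \<longleftrightarrow> l = k \<and> (\<exists>e\<in>A. ys = xs[k := e])"
proof
  assume eq: "omit l ys = omit k xs"
  have len: "length xs = Suc n" "length ys = Suc n"
    using assms by (auto simp: simplices_def)
  have "l = k"
  proof (rule ccontr)
    assume "l \<noteq> k"
    then consider "l < k" | "k < l" by linarith
    then show False
    proof cases
      case 1
      then have "ys ! Suc l = xs ! l"
        using arg_cong[OF eq, of "\<lambda>zs. zs ! l"] assms(3) len by (simp add: nth_omit)
      then show False
        using rank_nth[OF assms(1), of l] rank_nth[OF assms(2), of "Suc l"] 1 assms(3) by simp
    next
      case 2
      then have "xs ! Suc k = ys ! k"
        using arg_cong[OF eq, of "\<lambda>zs. zs ! k"] assms(4) len by (simp add: nth_omit)
      then show False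
        using rank_nth[OF assms(2), of k] rank_nth[OF assms(1), of "Suc k"] 2 assms(4) by simp
    qed
  qed
  moreover have "ys ! k \<in> A"
    using assms by (auto simp: simplices_def)
  ultimately show "l = k \<and> (\<exists>e\<in>A. ys = xs[k := e])"
    using eq_if_omit_eq[of k xs ys] eq len assms(3) by auto
qed auto

lemma lookup_boundary_omit:
  assumes c: "keys c \<subseteq> simplices A leq n" and xs: "xs \<in> simplices A leq n" and "k \<le> n"
  shows "lookup (boundary c) (omit k xs) = (-1) ^ k * (\<Sum>e\<in>A. lookup c (xs[k := e]))"
proof -
  let ?U = "(\<lambda>e. xs[k := e]) ` A"
  have len: "length xs = Suc n"
    using xs by (simp add: simplices_def)
  have "(\<Sum>l<length ys. if omit l ys = omit k xs then (-1) ^ l * lookup c ys else 0) =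
      (if ys \<in> ?U then (-1) ^ k * lookup c ys else 0)" if "ys \<in> keys c" for ys
  proof -
    have ys: "ys \<in> simplices A leq n" "length ys = Suc n"
      using c that by (auto simp: simplices_def)
    have "(\<Sum>l<length ys. if omit l ys = omit k xs then (-1) ^ l * lookup c ys else 0) =
       (\<Sum>l<length ys. if l = k then (if ys \<in> ?U then (-1) ^ k * lookup c ys else 0) else 0)"
      using omit_eq_iff[OF xs ys(1) \<open>k \<le> n\<close>] ys(2) by (intro sum.cong refl) auto
    also have "\<dots> = (if ys \<in> ?U then (-1) ^ k * lookup c ys else 0)"
      using \<open>k \<le> n\<close> ys(2) by simp
    finally show ?thesis .
  qed
  then have "lookup (boundary c) (omit k xs) =
      (\<Sum>ys\<in>keys c. if ys \<in> ?U then (-1) ^ k * lookup c ys else 0)"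
    unfolding lookup_boundary by (rule sum.cong[OF refl])
  also have "\<dots> = (\<Sum>ys\<in>?U. (-1) ^ k * lookup c ys)"
    by (rule sum.mono_neutral_cong) (use finite_carrier in \<open>auto simp: in_keys_iff\<close>)
  also have "\<dots> = (-1) ^ k * (\<Sum>ys\<in>?U. lookup c ys)"
    by (simp add: sum_distrib_left)
  also have "(\<Sum>ys\<in>?U. lookup c ys) = (\<Sum>e\<in>A. lookup c (xs[k := e]))"
    using len \<open>k \<le> n\<close>
    by (intro sum.reindex_cong[of "\<lambda>e. xs[k := e]"] inj_onI refl)
      (metis le_imp_less_Suc nth_list_update_eq)+
  finally show ?thesis .
qed

lemma cycles_iff:
  "c \<in> cycles A leq n \<longleftrightarrow>
    keys c \<subseteq> simplices A leq n \<and>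
    (\<forall>xs \<in> simplices A leq n. \<forall>k\<le>n. (\<Sum>e\<in>A. lookup c (xs[k := e])) = 0)"
    (is "_ \<longleftrightarrow> ?K \<and> ?S")
proof -
  have "boundary c = 0 \<longleftrightarrow> ?S" if K: ?K
  proof
    assume "boundary c = 0"
    then show ?S using lookup_boundary_omit[OF K] by fastforce
  next
    assume S: ?S
    have "lookup (boundary c) ys = 0" for ys
    proof (cases "\<exists>xs\<in>simplices A leq n. \<exists>k\<le>n. ys = omit k xs")
      case True
      then show ?thesis using lookup_boundary_omit[OF K] S by auto
    next
      case False
      then have "omit k xs \<noteq> ys" if "xs \<in> keys c" "k < length xs" for xs k
        
      proof -
        have "xs \<in> simplices A leq n" "length xs = Suc n"
          using that K by (auto simp: simplices_def)
        then show ?thesis using False that(2) by (metis less_Suc_eq_le)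
      qed
      then show ?thesis
        unfolding lookup_boundary by (intro sum.neutral ballI) simp
    qed
    then show "boundary c = 0" by (simp add: poly_mapping_eqI)
  qed
  then show ?thesis by (auto simp: cycles_def chain_group_def)
qed

end

section \<open>Faces of the cube\<close>

lemma length_face_le: "face_le x y \<Longrightarrow> length x = length y"
  by (auto simp: face_le_def dest: list_all2_lengthD)

lemma face_le_iff:
  "face_le x y \<longleftrightarrow> length x = length y \<and> (\<forall>a<length x. y ! a = x ! a \<or> y ! a = Star)"
  by (auto simp: face_le_def list_all2_conv_all_nth)

lemma face_le_trans: "\<lbrakk>face_le x y; face_le y z\<rbrakk> \<Longrightarrow> face_le x z"
  unfolding face_le_iff by (metis (full_types))

lemma st_le_length: "st x \<le> length x"
  by (simp add: st_def count_le_length)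

lemma st_eq_card: "st x = card {a. a < length x \<and> x ! a = Star}"
  unfolding st_def count_list_eq_length_filter length_filter_conv_card
  by (simp add: eq_commute)

lemma st_eq_0_iff: "st x = 0 \<longleftrightarrow> (\<forall>a<length x. x ! a \<noteq> Star)"
  by (auto simp: st_eq_card)

lemma st_eq_length_iff: "st x = length x \<longleftrightarrow> x = replicate (length x) Star"
proof
  assume "st x = length x"
  then have "{a. a < length x \<and> x ! a = Star} = {..<length x}"
    by (intro card_subset_eq) (auto simp: st_eq_card)
  then show "x = replicate (length x) Star"
    by (intro nth_equalityI) auto
next
  assume "x = replicate (length x) Star"
  then show "st x = length x"
    by (metis count_list_eq_length_filter filter_replicate length_replicate st_def)
qed

lemma st_update_Star: "\<lbrakk>a < length x; x ! a \<noteq> Star\<rbrakk> \<Longrightarrow> st (x[a := Star]) = Suc (st x)"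
proof -
  assume "a < length x" "x ! a \<noteq> Star"
  then have "{b. b < length x \<and> x[a := Star] ! b = Star} =
      insert a {b. b < length x \<and> x ! b = Star}"
    by (auto simp: nth_list_update)
  then show ?thesis
    using \<open>x ! a \<noteq> Star\<close> by (simp add: st_eq_card)
qed

lemma st_mono: "face_le x y \<Longrightarrow> st x \<le> st y"
  unfolding st_eq_card by (intro card_mono) (auto simp: face_le_iff)

lemma face_le_st_eq:
  assumes "face_le x y" "st x = st y"
  shows "x = y"
proof -
  have "{a. a < length x \<and> x ! a = Star} = {a. a < length y \<and> y ! a = Star}"
    using assms by (intro card_subset_eq) (auto simp: st_eq_card face_le_iff)
  then have "x ! a = Star \<longleftrightarrow> y ! a = Star" if "a < length x" for a
    using that length_face_le[OF assms(1)] by auto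
  then show ?thesis
    using assms(1) unfolding face_le_iff by (metis nth_equalityI)
qed

lemma face_le_antisym: "\<lbrakk>face_le x y; face_le y x\<rbrakk> \<Longrightarrow> x = y"
  by (meson face_le_st_eq le_antisym st_mono)

lemma face_le_update: "a < length x \<Longrightarrow> face_le x (x[a := Star])"
  by (auto simp: face_le_iff nth_list_update)

text \<open>A cover relation of faces turns one coordinate into a star. All arguments about
  neighbouring ranks below pass through this coordinate.\<close>

lemma face_cover:
  assumes "face_le x y" "st y = Suc (st x)"
  obtains a where "a < length x" "x ! a \<noteq> Star" "y = x[a := Star]"
proof -
  obtain a where a: "a < length x" "x ! a \<noteq> y ! a"
    using assms by (metis face_le_iff n_not_Suc_n nth_equalityI)
  then have "x ! a \<noteq> Star" "y ! a = Star"
    using assms(1) by (auto simp: face_le_iff)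
  moreover have "face_le (x[a := Star]) y"
    using assms(1) a calculation by (auto simp: face_le_iff nth_list_update)
  ultimately show thesis
    using that a assms face_le_st_eq st_update_Star by metis
qed

section \<open>The Rees product\<close>

fun face_of :: "rees \<Rightarrow> face" where
  "face_of (Elem e) = fst e"
| "face_of _ = []"

fun level_of :: "rees \<Rightarrow> nat" where
  "level_of (Elem e) = snd e"
| "level_of _ = 0"

abbreviation rank_of :: "rees \<Rightarrow> nat" where
  "rank_of e \<equiv> st (face_of e)"

definition proper_part :: "nat \<Rightarrow> rees set" where
  "proper_part n = {Elem (x, i) |x i. length x = n \<and> 1 \<le> i \<and> i \<le> st x + 1}"

lemma proper_part_eq: "rees_poset n - {Bot, Top} = proper_part n"
  by (auto simp: rees_poset_def proper_part_def)

lemma Elem_in_proper_part_iff: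
  "Elem e \<in> proper_part n \<longleftrightarrow> length (fst e) = n \<and> 1 \<le> snd e \<and> snd e \<le> st (fst e) + 1"
  by (cases e) (auto simp: proper_part_def)

lemma rees_le_Elem:
  "rees_le (Elem e) (Elem f) \<longleftrightarrow>
    face_le (fst e) (fst f) \<and> snd e \<le> snd f \<and> snd f - snd e \<le> st (fst f) - st (fst e)"
  using st_mono by (cases e; cases f) fastforce

lemma rees_le_trans:
  assumes "rees_le u v" "rees_le v w"
  shows "rees_le u w"
proof (cases "\<exists>e f g. u = Elem e \<and> v = Elem f \<and> w = Elem g")
  case True
  then obtain e f g where u: "u = Elem e" "v = Elem f" "w = Elem g" by blast
  then have "face_le (fst e) (fst f)" "face_le (fst f) (fst g)"
    using assms by (auto simp: rees_le_Elem)
  then show ?thesis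
    using assms u face_le_trans[of "fst e" "fst f" "fst g"]
      st_mono[of "fst e" "fst f"] st_mono[of "fst f" "fst g"]
    by (auto simp: rees_le_Elem simp del: rees_le.simps(3))
next
  case False
  then show ?thesis
    using assms by (cases u; cases v; cases w) auto
qed

lemma rees_le_antisym: "\<lbrakk>rees_le u v; rees_le v u\<rbrakk> \<Longrightarrow> u = v"
  by (cases u; cases v)
    (auto simp: rees_le_Elem prod_eq_iff simp del: rees_le.simps(3) intro: face_le_antisym)

lemma transp_rees_less: "transp (\<lambda>u v. rees_le u v \<and> u \<noteq> v)"
  by (rule transpI) (metis rees_le_trans rees_le_antisym)

lemma rees_less_rank:
  assumes "rees_le (Elem e) (Elem f)" "e \<noteq> f"
  shows "st (fst e) < st (fst f)"
proof -
  have "fst e \<noteq> fst f"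
    using assms by (auto simp: rees_le_Elem prod_eq_iff)
  then show ?thesis
    using assms(1) by (metis face_le_st_eq le_neq_implies_less rees_le_Elem st_mono)
qed

lemma finite_proper_part: "finite (proper_part n)"
proof -
  have "(UNIV :: coord set) \<subseteq> {Zero_coord, One_coord, Star}"
    using coord.exhaust by blast
  then have "finite (UNIV :: coord set)" by (rule finite_subset) simp
  then have "finite {x :: face. length x = n}"
    using finite_lists_length_eq[of UNIV n] by simp
  moreover have "proper_part n \<subseteq> Elem ` ({x. length x = n} \<times> {..n + 1})"
  proof -
    have "i \<le> n + 1" if "length x = n" "i \<le> st x + 1" for x i
      using that st_le_length[of x] by linarith
    then show ?thesis by (force simp: proper_part_def)
  qed
  ultimately show ?thesis
    by (auto intro: finite_subset)
qed

lemma graded_subset_proper_part: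
  assumes "A \<subseteq> proper_part n"
  shows "graded A rees_le rank_of n"
proof
  show "finite A"
    using assms finite_proper_part finite_subset by blast
  show "rank_of u < rank_of v" if "u \<in> A" "v \<in> A" "rees_le u v" "u \<noteq> v" for u v
  proof -
    have "u \<in> proper_part n" "v \<in> proper_part n" using assms that by auto
    then obtain e f where "u = Elem e" "v = Elem f"
      by (auto simp: proper_part_def)
    then show ?thesis using that rees_less_rank by auto
  qed
  show "rank_of u \<le> n" if "u \<in> A" for u
    using that assms st_le_length by (fastforce simp: proper_part_def)
qed

interpretation rees: graded "proper_part n" rees_le rank_of n for n
  by (rule graded_subset_proper_part) simp

text \<open>Strict comparability is transitive, so that a maximal chain can be checked and modified locally,
  one rank at a time.\<close>

lemma maximal_chain_iff:
  assumes "A \<subseteq> proper_part n"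
  shows "xs \<in> simplices A rees_le n \<longleftrightarrow>
    length xs = Suc n \<and> (\<forall>k\<le>n. xs ! k \<in> A \<and> rank_of (xs ! k) = k) \<and>
    (\<forall>k<n. rees_le (xs ! k) (xs ! Suc k))" (is "_ \<longleftrightarrow> ?R")
proof
  assume xs: "xs \<in> simplices A rees_le n"
  then show ?R
    using graded.rank_nth[OF graded_subset_proper_part[OF assms] xs] simplices_nth[OF xs]
    by (auto simp: simplices_def)
next
  assume R: ?R
  then have "xs ! k \<noteq> xs ! Suc k" if "k < n" for k
    using that by (metis Suc_leI less_imp_le_nat n_not_Suc_n)
  then show "xs \<in> simplices A rees_le n"
    using R unfolding simplices_def sorted_wrt_iff_nth_Suc_transp[OF transp_rees_less]
    by (auto simp: in_set_conv_nth less_Suc_eq_le)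
qed

section \<open>Barred signed words and maximal chains\<close>

text \<open>The words of \<open>falling_words\<close> without their descent conditions; they encode all maximal
  chains.\<close>

definition barred_words :: "nat \<Rightarrow> letter list set" where
  "barred_words n =
     {\<sigma>. length \<sigma> = n + 2 \<and> \<sigma> ! 0 = (0, False) \<and> \<sigma> ! (n + 1) = (int (n + 1), False) \<and>
         bij_betw (letter_index \<sigma>) {1..n} {1..n}}"

definition bar_drop :: "letter list \<Rightarrow> nat \<Rightarrow> bool" where
  "bar_drop \<sigma> i \<longleftrightarrow> barred \<sigma> i \<and> \<not> barred \<sigma> (Suc i)"

text \<open>At a position that is not a bar drop the falling condition asks for a descent, whatever the
  bars are there. Bar drops are also the ranks at which \<open>sphere\<close> singles out the element of \<open>m_chain\<close>,
  and this coincidence is what relates falling words to spheres.\<close>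

lemma falling_words_iff:
  "\<sigma> \<in> falling_words n \<longleftrightarrow> \<sigma> \<in> barred_words n \<and> (\<forall>i\<le>n. bar_drop \<sigma> i \<or> descent \<sigma> i)"
  unfolding falling_words_def barred_words_def bar_drop_def by blast

definition bars :: "letter list \<Rightarrow> nat \<Rightarrow> nat" where
  "bars \<sigma> i = (\<Sum>t = 1..i. of_bool (barred \<sigma> t))"

lemma bars_0 [simp]: "bars \<sigma> 0 = 0"
  by (simp add: bars_def)

lemma bars_Suc: "bars \<sigma> (Suc i) = bars \<sigma> i + of_bool (barred \<sigma> (Suc i))"
  by (simp add: bars_def)

lemma bars_le: "bars \<sigma> i \<le> i"
  by (induction i) (auto simp: bars_Suc)

lemma snd_m_chain: "snd (m_chain n \<sigma> i) = Suc (bars \<sigma> i)"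
  by (induction i) (simp_all add: bars_Suc)

lemma length_m_chain [simp]: "length (fst (m_chain n \<sigma> i)) = n"
  by (induction i) simp_all

lemma nth_m_chain_0:
  "a < n \<Longrightarrow> fst (m_chain n \<sigma> 0) ! a =
    (if \<exists>i\<in>{1..n}. fst (\<sigma> ! i) = int (Suc a) then One_coord else Zero_coord)"
  by (simp del: upt_Suc)

declare m_chain.simps(1) [simp del]

lemma vertex_not_Star: "a < n \<Longrightarrow> fst (m_chain n \<sigma> 0) ! a \<noteq> Star"
  by (simp add: nth_m_chain_0)

definition coord_value :: "face \<Rightarrow> nat \<Rightarrow> int" where
  "coord_value x a =
    (case x ! a of Zero_coord \<Rightarrow> - int (Suc a) | One_coord \<Rightarrow> int (Suc a) | Star \<Rightarrow> 0)"

context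
  fixes n :: nat and \<sigma> :: "letter list"
  assumes word: "\<sigma> \<in> barred_words n"
begin

lemma bij_letter_index: "bij_betw (letter_index \<sigma>) {1..n} {1..n}"
  using word by (simp add: barred_words_def)

lemma letter_index_bounds: "i \<in> {1..n} \<Longrightarrow> letter_index \<sigma> i \<in> {1..n}"
  using bij_letter_index bij_betwE by blast

lemma letter_index_eq_iff:
  "\<lbrakk>i \<in> {1..n}; j \<in> {1..n}\<rbrakk> \<Longrightarrow> letter_index \<sigma> i = letter_index \<sigma> j \<longleftrightarrow> i = j"
  using bij_betw_imp_inj_on[OF bij_letter_index] by (rule inj_on_eq_iff)

lemma obtain_letter:
  assumes "a < n"
  obtains i where "i \<in> {1..n}" "letter_index \<sigma> i = Suc a"
proof -
  have "Suc a \<in> letter_index \<sigma> ` {1..n}"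
    using bij_letter_index assms by (simp add: bij_betw_def)
  then show thesis using that by (metis imageE)
qed

lemma letter_value_nonzero: "i \<in> {1..n} \<Longrightarrow> fst (\<sigma> ! i) \<noteq> 0"
  using letter_index_bounds[of i] by (auto simp: letter_index_def)

lemma nth_m_chain:
  assumes "a < n" "i \<le> n"
  shows "fst (m_chain n \<sigma> i) ! a =
    (if Suc a \<in> letter_index \<sigma> ` {1..i} then Star else fst (m_chain n \<sigma> 0) ! a)"
  using assms(2)
proof (induction i)
  case (Suc i)
  have "letter_index \<sigma> (Suc i) - 1 = a \<longleftrightarrow> letter_index \<sigma> (Suc i) = Suc a"
    using letter_index_bounds[of "Suc i"] Suc.prems by auto
  then have "fst (m_chain n \<sigma> (Suc i)) ! a =
      (if Suc a = letter_index \<sigma> (Suc i) then Star else fst (m_chain n \<sigma> i) ! a)"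
    using assms(1) by (auto simp: nth_list_update)
  moreover have "letter_index \<sigma> ` {1..Suc i} =
      insert (letter_index \<sigma> (Suc i)) (letter_index \<sigma> ` {1..i})"
    by (simp add: atLeastAtMostSuc_conv)
  ultimately show ?case
    using Suc by (simp del: m_chain.simps)
qed simp

lemma nth_m_chain_eq_Star_iff:
  "\<lbrakk>a < n; i \<le> n\<rbrakk> \<Longrightarrow> fst (m_chain n \<sigma> i) ! a = Star \<longleftrightarrow> Suc a \<in> letter_index \<sigma> ` {1..i}"
  using nth_m_chain[of a i] vertex_not_Star[of a] by auto

text \<open>A coordinate that becomes a star at step \<open>j\<close> is still an entry of the starting vertex at
  all earlier ranks \<open>i\<close>, so the signed letter can be read off from any of them.\<close>

lemma letter_coord:
  assumes "i < j" "j \<le> n"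
  shows "letter_index \<sigma> j - 1 < n"
    and "fst (m_chain n \<sigma> i) ! (letter_index \<sigma> j - 1) \<noteq> Star"
    and "coord_value (fst (m_chain n \<sigma> i)) (letter_index \<sigma> j - 1) = fst (\<sigma> ! j)"
proof -
  let ?a = "letter_index \<sigma> j - 1"
  have j: "j \<in> {1..n}" using assms by auto
  then have a: "Suc ?a = letter_index \<sigma> j" "?a < n"
    using letter_index_bounds[of j] by auto
  then show "?a < n" by simp
  have free: "Suc ?a \<notin> letter_index \<sigma> ` {1..i}"
  proof
    assume "Suc ?a \<in> letter_index \<sigma> ` {1..i}"
    then obtain t where "t \<in> {1..i}" "letter_index \<sigma> t = letter_index \<sigma> j"
      unfolding a(1) by auto
    then show False
      using letter_index_eq_iff[of t j] assms by auto
  qed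
  then show "fst (m_chain n \<sigma> i) ! ?a \<noteq> Star"
    using nth_m_chain_eq_Star_iff[of ?a i] a(2) assms by auto
  have "(\<exists>t\<in>{1..n}. fst (\<sigma> ! t) = int (Suc ?a)) \<longleftrightarrow> fst (\<sigma> ! j) > 0"
  proof
    assume "\<exists>t\<in>{1..n}. fst (\<sigma> ! t) = int (Suc ?a)"
    then obtain t where t: "t \<in> {1..n}" "fst (\<sigma> ! t) = int (Suc ?a)" by blast
    then have "letter_index \<sigma> t = letter_index \<sigma> j"
      using a(1) by (simp add: letter_index_def)
    then show "fst (\<sigma> ! j) > 0"
      using letter_index_eq_iff[OF t(1) j] t(2) by auto
  next
    assume "fst (\<sigma> ! j) > 0"
    then have "fst (\<sigma> ! j) = int (Suc ?a)"
      unfolding a(1) by (simp add: letter_index_def)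
    then show "\<exists>t\<in>{1..n}. fst (\<sigma> ! t) = int (Suc ?a)" using j by blast
  qed
  moreover have "fst (m_chain n \<sigma> i) ! ?a = fst (m_chain n \<sigma> 0) ! ?a"
    using nth_m_chain[of ?a i] a(2) free assms by auto
  ultimately have "fst (m_chain n \<sigma> i) ! ?a = (if fst (\<sigma> ! j) > 0 then One_coord else Zero_coord)"
    using nth_m_chain_0[OF a(2), of \<sigma>] by presburger
  then show "coord_value (fst (m_chain n \<sigma> i)) ?a = fst (\<sigma> ! j)"
    using letter_value_nonzero[OF j] unfolding coord_value_def a(1)
    by (simp add: letter_index_def)
qed

lemma st_m_chain: "i \<le> n \<Longrightarrow> st (fst (m_chain n \<sigma> i)) = i"
proof (induction i)
  case 0
  then show ?case
    using vertex_not_Star unfolding st_eq_0_iff length_m_chain by blast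
next
  case (Suc i)
  then show ?case
    using letter_coord(1,2)[of i "Suc i"] by (simp add: st_update_Star)
qed

end

definition word_chain :: "nat \<Rightarrow> letter list \<Rightarrow> rees list" where
  "word_chain n \<sigma> = map (\<lambda>i. Elem (m_chain n \<sigma> i)) [0..<Suc n]"

lemma length_word_chain [simp]: "length (word_chain n \<sigma>) = Suc n"
  by (simp add: word_chain_def)

lemma nth_word_chain: "i \<le> n \<Longrightarrow> word_chain n \<sigma> ! i = Elem (m_chain n \<sigma> i)"
  by (simp add: word_chain_def del: upt_Suc)

lemma word_chain_maximal:
  assumes "\<sigma> \<in> barred_words n"
  shows "word_chain n \<sigma> \<in> simplices (proper_part n) rees_le n"
proof -
  have "Elem (m_chain n \<sigma> i) \<in> proper_part n" if "i \<le> n" for i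
    using snd_m_chain[of n \<sigma> i] st_m_chain[OF assms that] bars_le[of \<sigma> i] length_m_chain[of n \<sigma> i]
    by (auto simp: Elem_in_proper_part_iff simp del: m_chain.simps)
  moreover have "rees_le (Elem (m_chain n \<sigma> k)) (Elem (m_chain n \<sigma> (Suc k)))" if "k < n" for k
  proof -
    have "face_le (fst (m_chain n \<sigma> k)) (fst (m_chain n \<sigma> (Suc k)))"
      using letter_coord(1)[OF assms, of k "Suc k"] that by (simp add: face_le_update)
    then show ?thesis
      using st_m_chain[OF assms, of k] st_m_chain[OF assms, of "Suc k"] that
      by (simp add: rees_le_Elem snd_m_chain bars_Suc del: m_chain.simps)
  qed
  ultimately show ?thesis
    using st_m_chain[OF assms]
    by (subst maximal_chain_iff) (auto simp: nth_word_chain simp del: m_chain.simps)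
qed

text \<open>The word is read off from the chain: \<open>a k\<close> is the coordinate that becomes a star between
  the ranks \<open>k\<close> and \<open>k + 1\<close>, its sign comes from the vertex of the chain, and the letter is barred if
  the second coordinate changes. The \<open>a k\<close> are distinct because a star stays a star.\<close>

lemma maximal_chain_is_word_chain:
  assumes xs: "xs \<in> simplices (proper_part n) rees_le n"
  obtains \<sigma> where "\<sigma> \<in> barred_words n" "xs = word_chain n \<sigma>"
proof -
  define X J where "X k = face_of (xs ! k)" and "J k = level_of (xs ! k)" for k
  have R: "length xs = Suc n" "\<And>k. k \<le> n \<Longrightarrow> xs ! k \<in> proper_part n"
      "\<And>k. k \<le> n \<Longrightarrow> rank_of (xs ! k) = k" "\<And>k. k < n \<Longrightarrow> rees_le (xs ! k) (xs ! Suc k)"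
    using xs by (auto simp: maximal_chain_iff)
  have nth: "xs ! k = Elem (X k, J k)" if "k \<le> n" for k
    using R(2)[OF that] by (auto simp: proper_part_def X_def J_def)
  have X: "length (X k) = n" "st (X k) = k" "1 \<le> J k" "J k \<le> k + 1" if "k \<le> n" for k
    using R(2,3)[OF that] by (auto simp: nth[OF that] proper_part_def)
  have step: "face_le (X k) (X (Suc k))" "J k \<le> J (Suc k)" "J (Suc k) \<le> Suc (J k)"
    if "k < n" for k
    using R(4)[OF that] that X(2)[of k] X(2)[of "Suc k"]
    by (auto simp: nth rees_le_Elem simp del: rees_le.simps)
  have "\<forall>k\<in>{..<n}. \<exists>a. a < n \<and> X k ! a \<noteq> Star \<and> X (Suc k) = (X k)[a := Star]"
  proof
    fix k assume "k \<in> {..<n}"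
    then have "k < n" by simp
    then show "\<exists>a. a < n \<and> X k ! a \<noteq> Star \<and> X (Suc k) = (X k)[a := Star]"
      using face_cover[OF step(1)[OF \<open>k < n\<close>]] X[of k] X[of "Suc k"] by auto
  qed
  then obtain a where a: "\<And>k. k < n \<Longrightarrow> a k < n" "\<And>k. k < n \<Longrightarrow> X k ! a k \<noteq> Star"
      "\<And>k. k < n \<Longrightarrow> X (Suc k) = (X k)[a k := Star]"
    by (metis lessThan_iff)
  have starred: "X k ! a l = Star" if "l < k" "k \<le> n" for k l
    using that
  proof (induction k)
    case (Suc k)
    then have eq: "X (Suc k) = (X k)[a k := Star]" and len: "a k < length (X k)"
      using a(1,3)[of k] X(1)[of k] by simp_all
    show ?case
    proof (cases "a k = a l")
      case True
      then show ?thesis using eq len by simp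
    next
      case False
      then have "X k ! a l = Star" using Suc less_SucE by fastforce
      then show ?thesis using eq False by simp
    qed
  qed simp
  have inj: "a l \<noteq> a k" if "l < k" "k < n" for k l
    using starred[of l k] a(2)[of k] that by auto
  define letter :: "nat \<Rightarrow> letter" where "letter i =
    (if i = 0 then (0, False) else if i = n + 1 then (int (n + 1), False)
     else (coord_value (X 0) (a (i - 1)), J i \<noteq> J (i - 1)))" for i
  define \<sigma> where "\<sigma> = map letter [0..<n + 2]"
  have \<sigma>: "\<sigma> ! i = letter i" if "i \<le> n + 1" for i
    using that unfolding \<sigma>_def by (subst nth_map) (auto simp del: upt_Suc)
  have vertex: "X 0 ! b \<noteq> Star" if "b < n" for b
    using X(1,2)[of 0] that by (simp add: st_eq_0_iff)
  have abs_value: "nat \<bar>coord_value (X 0) b\<bar> = Suc b" if "b < n" for b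
    using vertex[OF that] by (cases "X 0 ! b") (auto simp: coord_value_def)
  have index: "letter_index \<sigma> i = Suc (a (i - 1))" if "i \<in> {1..n}" for i
  proof -
    have "i - 1 < n" using that by auto
    then show ?thesis
      using that a(1) by (simp add: letter_index_def \<sigma> letter_def abs_value)
  qed
  have "inj_on (letter_index \<sigma>) {1..n}"
  proof (rule inj_onI)
    fix i j assume ij: "i \<in> {1..n}" "j \<in> {1..n}" "letter_index \<sigma> i = letter_index \<sigma> j"
    then have "a (i - 1) = a (j - 1)" by (simp add: index)
    moreover have "i - 1 < n" "j - 1 < n" using ij by auto
    ultimately have "i - 1 = j - 1"
      using inj[of "i - 1" "j - 1"] inj[of "j - 1" "i - 1"] by (metis nat_neq_iff)
    then show "i = j" using ij by auto
  qed
  moreover have "letter_index \<sigma> ` {1..n} \<subseteq> {1..n}"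
  proof
    fix b assume "b \<in> letter_index \<sigma> ` {1..n}"
    then obtain i where i: "i \<in> {1..n}" "b = Suc (a (i - 1))" using index by auto
    then have "i - 1 < n" by auto
    then show "b \<in> {1..n}" using a(1)[of "i - 1"] i(2) by simp
  qed
  ultimately have bij: "bij_betw (letter_index \<sigma>) {1..n} {1..n}"
    by (simp add: bij_betw_def endo_inj_surj)
  have word: "\<sigma> \<in> barred_words n"
    using bij by (simp add: barred_words_def \<sigma>) (simp add: \<sigma>_def letter_def)
  have "m_chain n \<sigma> k = (X k, J k)" if "k \<le> n" for k
    using that
  proof (induction k)
    case 0
    have "fst (m_chain n \<sigma> 0) ! b = X 0 ! b" if "b < n" for b
    proof -
      obtain i where i: "i \<in> {1..n}" "letter_index \<sigma> i = Suc b"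
        using obtain_letter[OF word \<open>b < n\<close>] .
      then have "a (i - 1) = b" using index by simp
      then have "coord_value (fst (m_chain n \<sigma> 0)) b = coord_value (X 0) b"
        using letter_coord(3)[OF word, of 0 i] i by (simp add: \<sigma> letter_def)
      then show ?thesis
        using vertex_not_Star[OF that] vertex[OF that]
        by (auto simp: coord_value_def split: coord.splits)
    qed
    then have "fst (m_chain n \<sigma> 0) = X 0"
      using X(1)[of 0] by (intro nth_equalityI) simp_all
    moreover have "J 0 = 1" using X(3,4)[of 0] by simp
    ultimately show ?case by (simp add: prod_eq_iff snd_m_chain)
  next
    case (Suc k)
    then have "m_chain n \<sigma> k = (X k, J k)" by simp
    moreover have "J (Suc k) = J k \<or> J (Suc k) = Suc (J k)"
      using step[of k] Suc.prems by auto
    ultimately show ?case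
      using Suc.prems index[of "Suc k"] a(3)[of k] by (auto simp: \<sigma> letter_def)
  qed
  then have "xs = word_chain n \<sigma>"
    using R(1) nth by (intro nth_equalityI) (auto simp: nth_word_chain)
  then show thesis using that word by blast
qed

section \<open>Cycles are determined by falling chains\<close>

definition coord_sum :: "face \<Rightarrow> int" where
  "coord_sum x = (\<Sum>a<length x. coord_value x a)"

text \<open>Along a chain the coordinate sum loses the signed letter at each step, so that the potential of
  the element of rank \<open>i\<close> grows with its \<open>i\<close>-th signed letter and with its bar.\<close>

definition potential :: "rees \<Rightarrow> int" where
  "potential e = int (level_of e) - coord_sum (face_of e)"

lemma coord_sum_update_Star:
  assumes "a < length x"
  shows "coord_sum (x[a := Star]) = coord_sum x - coord_value x a"
proof -
  have "coord_sum (x[a := Star]) = (\<Sum>b\<in>{..<length x} - {a}. coord_value (x[a := Star]) b) +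
      coord_value (x[a := Star]) a"
    unfolding coord_sum_def using assms by (simp add: sum.remove[of _ a])
  also have "coord_value (x[a := Star]) a = 0"
    using assms by (simp add: coord_value_def)
  also have "(\<Sum>b\<in>{..<length x} - {a}. coord_value (x[a := Star]) b) =
      (\<Sum>b\<in>{..<length x} - {a}. coord_value x b)"
    by (rule sum.cong) (auto simp: coord_value_def)
  also have "\<dots> = coord_sum x - coord_value x a"
    unfolding coord_sum_def using assms by (simp add: sum.remove[of _ a])
  finally show ?thesis by simp
qed

text \<open>Another filling of rank \<open>i\<close> exchanges the letters \<open>i\<close> and \<open>i + 1\<close>, moves a bar between
  these two positions, or both; for \<open>i = 0\<close> it changes the sign of the first letter, and for \<open>i = n\<close> it
  toggles the bar of the last one. If \<open>i\<close> is neither a bar drop nor a descent, the filling at hand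
  takes the smaller letter first and the bar as late as possible (a positive first letter for
  \<open>i = 0\<close>, no bar for \<open>i = n\<close>), and every alternative has larger potential.\<close>

lemma potential_less_other_filling:
  assumes word: "\<sigma> \<in> barred_words n" and "1 \<le> n" "i \<le> n"
    and ascent: "\<not> bar_drop \<sigma> i" "\<not> descent \<sigma> i"
    and max: "(word_chain n \<sigma>)[i := e] \<in> simplices (proper_part n) rees_le n"
    and e_neq: "e \<noteq> Elem (m_chain n \<sigma> i)"
  shows "potential (Elem (m_chain n \<sigma> i)) < potential e"
proof -
  let ?ys = "(word_chain n \<sigma>)[i := e]"
  define X where "X k = fst (m_chain n \<sigma> k)" for k
  have R: "\<And>k. k \<le> n \<Longrightarrow> ?ys ! k \<in> proper_part n" "\<And>k. k \<le> n \<Longrightarrow> rank_of (?ys ! k) = k"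
      "\<And>k. k < n \<Longrightarrow> rees_le (?ys ! k) (?ys ! Suc k)"
    using max by (auto simp: maximal_chain_iff simp del: length_list_update)
  have ys_i: "?ys ! i = e"
    using \<open>i \<le> n\<close> by simp
  have ys_other: "?ys ! k = Elem (m_chain n \<sigma> k)" if "k \<le> n" "k \<noteq> i" for k
    using that by (simp add: nth_word_chain)
  have "e \<in> proper_part n" "rank_of e = i"
    using R(1,2)[OF \<open>i \<le> n\<close>] unfolding ys_i by simp_all
  moreover from this(1) obtain y j where "e = Elem (y, j)"
    unfolding proper_part_def by blast
  ultimately have e: "e = Elem (y, j)" "length y = n" "1 \<le> j" "j \<le> st y + 1" and st: "st y = i"
    by (simp_all add: Elem_in_proper_part_iff)
  have below: "rees_le (Elem (m_chain n \<sigma> p)) (Elem (y, j))" if "i = Suc p" for p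
    using R(3)[of p] that \<open>i \<le> n\<close> e(1) ys_i ys_other[of p] by simp
  have above: "rees_le (Elem (y, j)) (Elem (m_chain n \<sigma> (Suc i)))" if "i < n"
    using R(3)[OF that] that e(1) ys_i ys_other[of "Suc i"] by simp
  have e_neq': "y \<noteq> X i \<or> j \<noteq> Suc (bars \<sigma> i)"
    using e_neq e(1) by (auto simp: X_def prod_eq_iff snd_m_chain)
  have st_X: "st (X k) = k" "length (X k) = n" if "k \<le> n" for k
    using st_m_chain[OF word that] by (auto simp: X_def)
  have X_Suc: "X (Suc k) = (X k)[letter_index \<sigma> (Suc k) - 1 := Star]" for k
    by (simp add: X_def)
  have sum_X: "coord_sum (X (Suc k)) = coord_sum (X k) - fst (\<sigma> ! Suc k)" if "k < n" for k
    using coord_sum_update_Star[of "letter_index \<sigma> (Suc k) - 1" "X k"]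
      letter_coord[OF word, of k "Suc k"] that st_X(2)[of k] by (simp add: X_def)
  show ?thesis
  proof (cases i)
    case 0
    then have "face_le y (X 1)" "st (X 1) = Suc (st y)"
      using above \<open>1 \<le> n\<close> st_X[of 1] st by (simp_all add: rees_le_Elem X_def del: m_chain.simps)
    then obtain b where b: "b < n" "y ! b \<noteq> Star" "X 1 = y[b := Star]"
      using face_cover e(2) by metis
    have "Suc b \<in> letter_index \<sigma> ` {1..1}"
      using nth_m_chain_eq_Star_iff[OF word \<open>b < n\<close>, of 1] b e(2) \<open>1 \<le> n\<close>
      by (simp add: X_def del: m_chain.simps)
    then have b_index: "b = letter_index \<sigma> 1 - 1" by simp
    have val: "coord_value (X 0) b = fst (\<sigma> ! 1)"
      using letter_coord(3)[OF word, of 0 1] \<open>1 \<le> n\<close> b_index by (simp add: X_def)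
    have "fst (\<sigma> ! 0) = 0"
      using word by (simp add: barred_words_def)
    then have pos: "fst (\<sigma> ! 1) > 0"
      using ascent(2) 0 letter_value_nonzero[OF word, of 1] \<open>1 \<le> n\<close> by (simp add: descent_def)
    then have One: "X 0 ! b = One_coord"
      using val by (auto simp: coord_value_def split: coord.splits)
    have "y = (X 0)[b := y ! b]"
    proof -
      have "y[b := Star] = (X 0)[b := Star]"
        using b(3) X_Suc[of 0] b_index by simp
      then show ?thesis by (metis list_update_id list_update_overwrite)
    qed
    moreover have "j = 1" using e(3,4) st 0 by simp
    ultimately have "y ! b \<noteq> One_coord"
      using One e_neq' 0 by (metis One_nat_def bars_0 list_update_id)
    then have "coord_value y b < 0"
      using b(2) by (cases "y ! b") (simp_all add: coord_value_def)
    moreover have "coord_sum y = coord_sum (X 1) + coord_value y b"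
      using coord_sum_update_Star[of b y] b e(2) by simp
    ultimately have "coord_sum y < coord_sum (X 0)"
      using sum_X[of 0] \<open>1 \<le> n\<close> pos by simp
    then show ?thesis
      using 0 \<open>j = 1\<close> e(1) by (simp add: potential_def X_def snd_m_chain)
  next
    case (Suc p)
    have p: "p < n" using Suc \<open>i \<le> n\<close> by simp
    have le: "face_le (X p) y" "Suc (bars \<sigma> p) \<le> j"
      using below[OF Suc] by (simp_all add: rees_le_Elem snd_m_chain X_def)
    then obtain b where b: "b < n" "X p ! b \<noteq> Star" "y = (X p)[b := Star]"
      using face_cover[OF le(1)] st_X[of p] st Suc p by (metis less_imp_le)
    have sum_y: "coord_sum y = coord_sum (X p) - coord_value (X p) b"
      using coord_sum_update_Star[of b "X p"] b st_X[of p] p by simp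
    have sum_i: "coord_sum (X i) = coord_sum (X p) - fst (\<sigma> ! i)"
      using sum_X[OF p] Suc by simp
    have fresh: "Suc b \<notin> letter_index \<sigma> ` {1..p}"
      using nth_m_chain_eq_Star_iff[OF word b(1), of p] b(2) p by (simp add: X_def)
    have same: "y = X i" if "Suc b = letter_index \<sigma> i"
      using that b(3) X_Suc[of p] Suc by (metis diff_Suc_1)
    have level: "bars \<sigma> i = bars \<sigma> p + of_bool (barred \<sigma> i)"
      using Suc by (simp add: bars_Suc)
    show ?thesis
    proof (cases "i = n")
      case True
      then have "\<not> barred \<sigma> i"
        using ascent(1) word by (auto simp: bar_drop_def barred_words_def)
      moreover have "y = X i"
        using st_eq_length_iff[of y] st_eq_length_iff[of "X i"] st e(2) True st_X[of i] by simp
      ultimately show ?thesis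
        using e_neq' le(2) e(1) level by (simp add: potential_def X_def snd_m_chain)
    next
      case False
      then have "i < n" using \<open>i \<le> n\<close> by simp
      have le': "face_le y (X (Suc i))" "j \<le> Suc (bars \<sigma> (Suc i))" "bars \<sigma> (Suc i) \<le> j"
        using above[OF \<open>i < n\<close>] st_X(1)[of "Suc i"] st \<open>i < n\<close>
        by (simp_all add: rees_le_Elem snd_m_chain X_def le_diff_conv del: m_chain.simps)
      have "y ! b = Star" using b st_X(2)[of p] p by simp
      then have "X (Suc i) ! b = Star"
        using le'(1) b(1) e(2) by (metis face_le_iff)
      then have "Suc b \<in> letter_index \<sigma> ` {1..Suc i}"
        using nth_m_chain_eq_Star_iff[OF word b(1), of "Suc i"] \<open>i < n\<close> by (simp add: X_def)
      then have "Suc b = letter_index \<sigma> i \<or> Suc b = letter_index \<sigma> (Suc i)"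
        using fresh Suc by (auto simp: atLeastAtMostSuc_conv)
      then show ?thesis
      proof
        assume "Suc b = letter_index \<sigma> i"
        then have "y = X i" by (rule same)
        then have "j \<noteq> Suc (bars \<sigma> i)" using e_neq' by simp
        moreover have "barred \<sigma> (Suc i)" if "barred \<sigma> i"
          using ascent(1) that by (simp add: bar_drop_def)
        ultimately have "Suc (bars \<sigma> i) < j"
          using level le(2) le' by (cases "barred \<sigma> i") (auto simp: bars_Suc)
        then show ?thesis
          using e(1) \<open>y = X i\<close> by (simp add: potential_def X_def snd_m_chain)
      next
        assume b': "Suc b = letter_index \<sigma> (Suc i)"
        then have "b = letter_index \<sigma> (Suc i) - 1" by simp
        then have "coord_value (X p) b = fst (\<sigma> ! Suc i)"
          using letter_coord(3)[OF word, of p "Suc i"] Suc \<open>i < n\<close> by (simp add: X_def)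
        moreover have "fst (\<sigma> ! i) \<noteq> fst (\<sigma> ! Suc i)"
          using letter_index_eq_iff[OF word, of i "Suc i"] Suc \<open>i < n\<close>
          by (auto simp: letter_index_def)
        then have "fst (\<sigma> ! i) < fst (\<sigma> ! Suc i)"
          using ascent(2) by (simp add: descent_def)
        moreover have "Suc (bars \<sigma> i) \<le> j"
          using level le(2) le' ascent(1)
          by (cases "barred \<sigma> i") (auto simp: bars_Suc bar_drop_def)
        ultimately show ?thesis
          using sum_i sum_y e(1) by (simp add: potential_def X_def snd_m_chain)
      qed
    qed
  qed
qed

text \<open>A chain of largest total potential in the support of a cycle must be falling: at a position
  that violates the falling condition, all the other fillings have larger total potential, so they
  are not in the support, and the equation of the cycle at this rank would have one nonzero term.\<close>

lemma cycle_zero_if_zero_on_falling_chains: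
  assumes "1 \<le> n" and z: "z \<in> cycles (proper_part n) rees_le n"
    and zero: "\<And>\<tau>. \<tau> \<in> falling_words n \<Longrightarrow> lookup z (word_chain n \<tau>) = 0"
  shows "z = 0"
proof (rule ccontr)
  assume "z \<noteq> 0"
  define total where "total xs = (\<Sum>k<length xs. potential (xs ! k))" for xs
  have fin: "finite (total ` keys z)" "total ` keys z \<noteq> {}"
    using \<open>z \<noteq> 0\<close> by auto
  obtain xs where xs: "xs \<in> keys z" "total xs = Max (total ` keys z)"
    using Max_in[OF fin] by auto
  have greatest: "total ys \<le> total xs" if "ys \<in> keys z" for ys
    using Max_ge[OF fin(1)] that xs(2) by simp
  have keys: "keys z \<subseteq> simplices (proper_part n) rees_le n"
    using z rees.cycles_iff by blast
  then obtain \<sigma> where \<sigma>: "\<sigma> \<in> barred_words n" "xs = word_chain n \<sigma>"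
    using xs(1) maximal_chain_is_word_chain by blast
  have "\<sigma> \<notin> falling_words n"
    using zero[of \<sigma>] xs(1) \<sigma>(2) by (auto simp: in_keys_iff)
  then obtain i where i: "i \<le> n" "\<not> bar_drop \<sigma> i" "\<not> descent \<sigma> i"
    using \<sigma>(1) falling_words_iff by blast
  have len: "i < length xs" using i(1) \<sigma>(2) by simp
  have nth: "xs ! i = Elem (m_chain n \<sigma> i)"
    using i(1) \<sigma>(2) by (simp add: nth_word_chain)
  have "lookup z (xs[i := e]) = 0" if "e \<noteq> xs ! i" for e
  proof (rule ccontr)
    assume "lookup z (xs[i := e]) \<noteq> 0"
    then have ys: "xs[i := e] \<in> keys z" by (simp add: in_keys_iff)
    then have "potential (xs ! i) < potential e"
      using potential_less_other_filling[OF \<sigma>(1) \<open>1 \<le> n\<close> i] keys that \<sigma>(2) nth by auto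
    moreover have "total (xs[i := e]) = total xs + potential e - potential (xs ! i)"
      using len by (simp add: total_def sum.remove[of "{..<length xs}" i])
    ultimately show False using greatest[OF ys] by simp
  qed
  then have "(\<Sum>e\<in>proper_part n. lookup z (xs[i := e])) =
      (\<Sum>e\<in>proper_part n. if e = xs ! i then lookup z xs else 0)"
    by (intro sum.cong refl) auto
  also have "\<dots> = lookup z xs"
    using finite_proper_part[of n] keys xs(1) i(1) simplices_nth(1)[of xs "proper_part n" rees_le n i]
    by auto
  also have "(\<Sum>e\<in>proper_part n. lookup z (xs[i := e])) = 0"
    using z xs(1) keys i(1) rees.cycles_iff by blast
  finally show False using xs(1) by (simp add: in_keys_iff)
qed

section \<open>The sphere of a falling falling_is_barred_word\<close>

text \<open>The second coordinate of the elements of rank \<open>i < n\<close> of the sphere: that of the \<open>i\<close>-th element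
  of \<open>m_chain\<close>, except that at a bar drop only this element has already been raised.\<close>

definition sphere_level :: "nat \<Rightarrow> letter list \<Rightarrow> nat \<Rightarrow> face \<Rightarrow> nat" where
  "sphere_level n \<sigma> i x =
    Suc (bars \<sigma> i) - (if bar_drop \<sigma> i \<and> x \<noteq> fst (m_chain n \<sigma> i) then 1 else 0)"

lemma sphere_level_m_chain: "sphere_level n \<sigma> i (fst (m_chain n \<sigma> i)) = snd (m_chain n \<sigma> i)"
  by (simp add: sphere_level_def snd_m_chain)

lemma sphere_level_no_drop: "\<not> bar_drop \<sigma> i \<Longrightarrow> sphere_level n \<sigma> i x = Suc (bars \<sigma> i)"
  by (simp add: sphere_level_def)

definition flip :: "coord \<Rightarrow> coord" where
  "flip c = (case c of Zero_coord \<Rightarrow> One_coord | One_coord \<Rightarrow> Zero_coord | Star \<Rightarrow> Star)"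

lemma flip_neq: "c \<noteq> Star \<Longrightarrow> flip c \<noteq> c" and flip_not_Star: "c \<noteq> Star \<Longrightarrow> flip c \<noteq> Star"
  by (cases c; simp add: flip_def)+

lemma flip_cases: "\<lbrakk>c \<noteq> Star; d \<noteq> Star; d \<noteq> c\<rbrakk> \<Longrightarrow> d = flip c"
  by (cases c; cases d; simp add: flip_def)

lemma st_update_not_Star:
  assumes "a < length x" "x ! a \<noteq> Star" "c \<noteq> Star"
  shows "st (x[a := c]) = st x"
proof -
  have "{b. b < length x \<and> x[a := c] ! b = Star} = {b. b < length x \<and> x ! b = Star}"
    using assms by (auto simp: nth_list_update split: if_splits)
  then show ?thesis by (simp add: st_eq_card)
qed

context
  fixes n :: nat and \<sigma> :: "letter list"
  assumes n_pos: "1 \<le> n" and falling: "\<sigma> \<in> falling_words n"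
begin

lemma falling_is_barred_word: "\<sigma> \<in> barred_words n"
  using falling falling_words_iff by blast

lemma barred_last: "barred \<sigma> n"
proof -
  have "\<bar>fst (\<sigma> ! n)\<bar> \<le> int n"
    using letter_index_bounds[OF falling_is_barred_word, of n] n_pos by (auto simp: letter_index_def)
  then have "\<not> descent \<sigma> n"
    using falling_is_barred_word by (auto simp: descent_def barred_words_def)
  then show ?thesis
    using falling by (auto simp: falling_words_iff bar_drop_def)
qed

lemma no_drop_0: "\<not> bar_drop \<sigma> 0"
  using falling_is_barred_word by (simp add: bar_drop_def barred_words_def)

lemma no_drop_before_last: "Suc p = n \<Longrightarrow> \<not> bar_drop \<sigma> p"
  using barred_last by (auto simp: bar_drop_def)

lemma bars_last: "Suc p = n \<Longrightarrow> bars \<sigma> n = Suc (bars \<sigma> p)"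
  using barred_last bars_Suc[of \<sigma> p] by auto

lemma sphere_rank_lower_imp:
  "sphere_rank n \<sigma> i e \<Longrightarrow> i < n \<Longrightarrow>
    length (fst e) = n \<and> st (fst e) = i \<and> snd e = sphere_level n \<sigma> i (fst e)"
proof (induction rule: sphere_rank.induct)
  case (vertex x)
  then show ?case using no_drop_0 by (simp add: sphere_level_no_drop)
next
  case (unbarred_unbarred i y k x)
  obtain p where i: "i = Suc p" using unbarred_unbarred.hyps by (cases i) auto
  have "k = Suc (bars \<sigma> p)"
    using unbarred_unbarred i by (simp add: sphere_level_no_drop bar_drop_def)
  then show ?case
    using unbarred_unbarred i by (simp add: sphere_level_no_drop bar_drop_def bars_Suc)
next
  case (barred_barred i y k x)
  obtain p where i: "i = Suc p" using barred_barred.hyps by (cases i) auto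
  have "k = Suc (bars \<sigma> p)"
    using barred_barred i by (simp add: sphere_level_no_drop bar_drop_def)
  then show ?case
    using barred_barred i by (simp add: sphere_level_no_drop bar_drop_def bars_Suc)
next
  case (barred_unbarred i y k x)
  obtain p where i: "i = Suc p" using barred_unbarred.hyps by (cases i) auto
  have "k = Suc (bars \<sigma> p)"
    using barred_unbarred i by (simp add: sphere_level_no_drop bar_drop_def)
  then show ?case
    using barred_unbarred i by (simp add: sphere_level_def bar_drop_def bars_Suc del: m_chain.simps)
next
  case (unbarred_after_barred i y k x)
  obtain p where i: "i = Suc p" using unbarred_after_barred.hyps by (cases i) auto
  have k: "k = sphere_level n \<sigma> p y"
    using unbarred_after_barred i by simp
  moreover have "y \<noteq> fst (m_chain n \<sigma> p)"
    using unbarred_after_barred.hyps(6) k sphere_level_m_chain[of n \<sigma> p] i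
    by (auto simp: prod_eq_iff)
  ultimately have "k = bars \<sigma> p"
    using unbarred_after_barred i by (simp add: sphere_level_def bar_drop_def)
  then show ?case
    using unbarred_after_barred i by (simp add: sphere_level_no_drop bar_drop_def bars_Suc)
qed simp_all

text \<open>The only case in which the choice of the element of rank \<open>i - 1\<close> matters is that of an
  unbarred letter after a barred one. There the rule needs a face of rank \<open>i - 1\<close> that is not the one
  in \<open>m_chain\<close>; flipping an entry of the latter gives one.\<close>

lemma sphere_rank_level:
  "\<lbrakk>i < n; length x = n; st x = i\<rbrakk> \<Longrightarrow> sphere_rank n \<sigma> i (x, sphere_level n \<sigma> i x)"
proof (induction i arbitrary: x)
  case 0
  then show ?case
    using sphere_rank.vertex[of x n \<sigma>] no_drop_0 by (simp add: sphere_level_no_drop)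
next
  case (Suc p)
  define y where "y = fst (m_chain n \<sigma> p)"
  have p: "1 \<le> Suc p" "Suc p \<le> n - 1" "p < n" using Suc.prems by auto
  have y: "length y = n" "st y = p"
    unfolding y_def using st_m_chain[OF falling_is_barred_word, of p] p by simp_all
  show ?case
  proof (cases "barred \<sigma> (Suc p)")
    case True
    have prev: "sphere_rank n \<sigma> (Suc p - 1) (y, Suc (bars \<sigma> p))"
      using Suc.IH[OF p(3) y] True by (simp add: sphere_level_no_drop bar_drop_def)
    show ?thesis
    proof (cases "barred \<sigma> (Suc p + 1)")
      case barred: True
      show ?thesis
        using sphere_rank.barred_barred[OF p(1,2) True barred prev Suc.prems(2,3)] True barred
        by (simp add: sphere_level_no_drop bar_drop_def bars_Suc)
    next
      case unbarred: False
      have "sphere_level n \<sigma> (Suc p) x = (if x = fst (m_chain n \<sigma> (Suc p))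
          then Suc (bars \<sigma> p) + 1 else Suc (bars \<sigma> p))"
        using True unbarred by (simp add: sphere_level_def bar_drop_def bars_Suc del: m_chain.simps)
      then show ?thesis
        using sphere_rank.barred_unbarred[OF p(1,2) True unbarred prev Suc.prems(2,3)]
        by (simp del: m_chain.simps)
    qed
  next
    case False
    show ?thesis
    proof (cases "barred \<sigma> p")
      case True
      define a where "a = letter_index \<sigma> (Suc p) - 1"
      define y' where "y' = y[a := flip (y ! a)]"
      have a: "a < n" "y ! a \<noteq> Star"
        using letter_coord(1,2)[OF falling_is_barred_word, of p "Suc p"] p by (simp_all add: a_def y_def)
      have y': "length y' = n" "st y' = p"
        using a y flip_not_Star by (simp_all add: y'_def st_update_not_Star)
      have "y' ! a \<noteq> y ! a" using a y flip_neq by (simp add: y'_def)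
      then have neq: "y' \<noteq> fst (m_chain n \<sigma> p)" by (auto simp: y_def)
      then have "sphere_level n \<sigma> p y' = bars \<sigma> p"
        using True False by (simp add: sphere_level_def bar_drop_def)
      then have prev: "sphere_rank n \<sigma> (Suc p - 1) (y', bars \<sigma> p)"
        using Suc.IH[OF p(3) y'] by simp
      have "(y', bars \<sigma> p) \<noteq> m_chain n \<sigma> (Suc p - 1)"
        using neq by (metis diff_Suc_1 fst_conv)
      moreover have "barred \<sigma> (Suc p - 1)" using True by simp
      ultimately show ?thesis
        using sphere_rank.unbarred_after_barred[OF p(1,2) _ False prev _ Suc.prems(2,3)] False
        by (simp add: sphere_level_no_drop bar_drop_def bars_Suc)
    next
      case unbarred: False
      have prev: "sphere_rank n \<sigma> (Suc p - 1) (y, Suc (bars \<sigma> p))"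
        using Suc.IH[OF p(3) y] unbarred by (simp add: sphere_level_no_drop bar_drop_def)
      show ?thesis
        using sphere_rank.unbarred_unbarred[OF p(1,2) _ False prev Suc.prems(2,3)] False unbarred
        by (simp add: sphere_level_no_drop bar_drop_def bars_Suc)
    qed
  qed
qed

lemma sphere_rank_last_iff:
  "sphere_rank n \<sigma> n e \<longleftrightarrow>
    e = (replicate n Star, bars \<sigma> n) \<or> e = (replicate n Star, Suc (bars \<sigma> n))"
proof -
  obtain p where p: "n = Suc p" using n_pos by (cases n) auto
  have k: "k = bars \<sigma> n" if "sphere_rank n \<sigma> (n - 1) (y, k)" for y k
    using sphere_rank_lower_imp[OF that] n_pos p no_drop_before_last[of p] bars_last[of p]
    by (simp add: sphere_level_no_drop)
  define y where "y = fst (m_chain n \<sigma> p)"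
  have "length y = n" "st y = p"
    unfolding y_def using st_m_chain[OF falling_is_barred_word, of p] p by simp_all
  then have prev: "sphere_rank n \<sigma> (n - 1) (y, bars \<sigma> n)"
    using sphere_rank_level[of p y] p no_drop_before_last[of p] bars_last[of p]
    by (simp add: sphere_level_no_drop)
  show ?thesis
  proof
    assume "sphere_rank n \<sigma> n e"
    then show "e = (replicate n Star, bars \<sigma> n) \<or> e = (replicate n Star, Suc (bars \<sigma> n))"
      by (cases rule: sphere_rank.cases) (use n_pos k in auto)
  next
    assume "e = (replicate n Star, bars \<sigma> n) \<or> e = (replicate n Star, Suc (bars \<sigma> n))"
    then show "sphere_rank n \<sigma> n e"
      using sphere_rank.top_lower[OF n_pos prev] sphere_rank.top_upper[OF n_pos prev] by auto
  qed
qed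

text \<open>The sphere is a copy of the poset of nonempty faces of the cube, except that the top face
  occurs twice.\<close>

lemma in_sphere_iff:
  "Elem (x, j) \<in> sphere n \<sigma> \<longleftrightarrow> length x = n \<and>
    (if st x < n then j = sphere_level n \<sigma> (st x) x else j = bars \<sigma> n \<or> j = Suc (bars \<sigma> n))"
    (is "_ \<longleftrightarrow> ?R")
proof
  assume "Elem (x, j) \<in> sphere n \<sigma>"
  then obtain i where i: "i \<le> n" "sphere_rank n \<sigma> i (x, j)"
    by (auto simp: sphere_def)
  show ?R
  proof (cases "i = n")
    case True
    then have "x = replicate n Star" "j = bars \<sigma> n \<or> j = Suc (bars \<sigma> n)"
      using i(2) sphere_rank_last_iff by auto
    then show ?thesis using st_eq_length_iff[of x] by simp
  next
    case False
    then show ?thesis using i sphere_rank_lower_imp[OF i(2)] by simp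
  qed
next
  assume R: ?R
  show "Elem (x, j) \<in> sphere n \<sigma>"
  proof (cases "st x < n")
    case True
    then show ?thesis
      using R sphere_rank_level[of "st x" x] by (auto simp: sphere_def intro: less_imp_le)
  next
    case False
    then have "x = replicate n Star"
      using R st_le_length[of x] st_eq_length_iff[of x] by simp
    then have "sphere_rank n \<sigma> n (x, j)"
      using R False sphere_rank_last_iff by simp
    then show ?thesis by (auto simp: sphere_def)
  qed
qed

lemma sphere_subset_proper_part: "sphere n \<sigma> \<subseteq> proper_part n"
proof
  fix e assume e: "e \<in> sphere n \<sigma>"
  then obtain x j where x: "e = Elem (x, j)" by (auto simp: sphere_def)
  have pos: "1 \<le> bars \<sigma> i" if "barred \<sigma> i" "i \<noteq> 0" for i
    using that by (cases i) (simp_all add: bars_Suc)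
  have "1 \<le> j \<and> j \<le> st x + 1 \<and> length x = n"
  proof (cases "st x < n")
    case True
    then have "j = sphere_level n \<sigma> (st x) x" "length x = n"
      using e x in_sphere_iff by auto
    moreover have "1 \<le> bars \<sigma> (st x)" if "bar_drop \<sigma> (st x)"
      using that pos[of "st x"] no_drop_0 by (cases "st x = 0") (auto simp: bar_drop_def)
    ultimately show ?thesis
      using bars_le[of \<sigma> "st x"] by (auto simp: sphere_level_def simp del: One_nat_def)
  next
    case False
    then have "j = bars \<sigma> n \<or> j = Suc (bars \<sigma> n)" "length x = n" "st x = n"
      using e x in_sphere_iff st_le_length[of x] by auto
    then show ?thesis
      using bars_le[of \<sigma> n] pos[of n] barred_last n_pos by auto
  qed
  then show "e \<in> proper_part n" using x by (auto simp: proper_part_def)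
qed

text \<open>The second coordinate grows by 0 or 1 along each cover relation of faces, so every
  cover relation of faces is one of elements of the sphere.\<close>

lemma sphere_cover:
  assumes "Elem (x, j) \<in> sphere n \<sigma>" "Elem (y, k) \<in> sphere n \<sigma>"
    and "face_le x y" "st y = Suc (st x)"
  shows "rees_le (Elem (x, j)) (Elem (y, k))"
proof -
  have "st y \<le> n"
    using assms(2) in_sphere_iff st_le_length[of y] by auto
  then have lt: "st x < n" using assms(4) by simp
  then have j: "j = sphere_level n \<sigma> (st x) x"
    using assms(1) in_sphere_iff by simp
  have "j \<le> k \<and> k \<le> Suc j"
  proof (cases "st y < n")
    case True
    then have k: "k = sphere_level n \<sigma> (Suc (st x)) y"
      using assms(2,4) in_sphere_iff by simp
    then show ?thesis
      using j by (auto simp: sphere_level_def bar_drop_def bars_Suc simp del: m_chain.simps)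
  next
    case False
    then have n: "Suc (st x) = n" using \<open>st y \<le> n\<close> assms(4) by simp
    then have "j = bars \<sigma> n"
      using j no_drop_before_last[OF n] bars_last[OF n] by (simp add: sphere_level_no_drop)
    then show ?thesis using assms(2) False in_sphere_iff by auto
  qed
  then show ?thesis using assms(3,4) by (auto simp: rees_le_Elem simp del: rees_le.simps)
qed

lemma sphere_chain_iff:
  "xs \<in> simplices (sphere n \<sigma>) rees_le n \<longleftrightarrow>
    length xs = Suc n \<and> (\<forall>k\<le>n. xs ! k \<in> sphere n \<sigma> \<and> rank_of (xs ! k) = k) \<and>
    (\<forall>k<n. face_le (face_of (xs ! k)) (face_of (xs ! Suc k)))"
proof -
  have "rees_le (xs ! k) (xs ! Suc k) \<longleftrightarrow> face_le (face_of (xs ! k)) (face_of (xs ! Suc k))"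
    if "\<forall>k\<le>n. xs ! k \<in> sphere n \<sigma> \<and> rank_of (xs ! k) = k" "k < n" for k
  proof -
    have mem: "xs ! k \<in> sphere n \<sigma>" "xs ! Suc k \<in> sphere n \<sigma>"
      and rk: "rank_of (xs ! k) = k" "rank_of (xs ! Suc k) = Suc k"
      using that by auto
    obtain x j y l where "xs ! k = Elem (x, j)" "xs ! Suc k = Elem (y, l)"
      using mem by (auto simp: sphere_def)
    then show ?thesis
      using sphere_cover[of x j y l] mem rk by (auto simp: rees_le_Elem simp del: rees_le.simps)
  qed
  then show ?thesis
    unfolding maximal_chain_iff[OF sphere_subset_proper_part] by blast
qed

lemma word_chain_in_sphere: "word_chain n \<sigma> \<in> simplices (sphere n \<sigma>) rees_le n"
proof -
  have "Elem (m_chain n \<sigma> k) \<in> sphere n \<sigma>" if "k \<le> n" for k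
  proof -
    have "Elem (fst (m_chain n \<sigma> k), snd (m_chain n \<sigma> k)) \<in> sphere n \<sigma>"
      using that st_m_chain[OF falling_is_barred_word that] sphere_level_m_chain[of n \<sigma> k]
      by (subst in_sphere_iff) (auto simp: snd_m_chain simp del: m_chain.simps)
    then show ?thesis by simp
  qed
  then show ?thesis
    using word_chain_maximal[OF falling_is_barred_word]
    by (simp add: maximal_chain_iff maximal_chain_iff[OF sphere_subset_proper_part] nth_word_chain
        del: m_chain.simps)
qed

end

section \<open>The fundamental cycle of the sphere\<close>

text \<open>The incidence number of the face \<open>x\<close> in the cube cell obtained by making \<open>a\<close> a star, for
  the product orientation: \<open>\<plusminus>1\<close> for the two ends of the interval, with a sign for moving past the
  preceding interval factors.\<close>

definition coord_incidence :: "face \<Rightarrow> nat \<Rightarrow> int" where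
  "coord_incidence x a = (-1) ^ st (take a x) * (if x ! a = One_coord then 1 else -1)"

text \<open>A cell and its facet differ in one coordinate, so the least one in which they differ is
  that coordinate.\<close>

definition incidence :: "face \<Rightarrow> face \<Rightarrow> int" where
  "incidence x y = coord_incidence x (LEAST a. x ! a \<noteq> y ! a)"

lemma incidence_update:
  assumes "a < length x" "x ! a \<noteq> Star"
  shows "incidence x (x[a := Star]) = coord_incidence x a"
proof -
  have "(LEAST b. x ! b \<noteq> x[a := Star] ! b) = a"
    using assms by (intro Least_equality) (auto, metis nth_list_update_neq order.refl)
  then show ?thesis by (simp add: incidence_def)
qed

lemma abs_incidence: "\<bar>incidence x y\<bar> = 1"
  by (simp add: incidence_def coord_incidence_def abs_mult)

lemma incidence_flip:
  assumes "a < length x" "x ! a \<noteq> Star"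
  shows "incidence (x[a := flip (x ! a)]) (x[a := Star]) = - incidence x (x[a := Star])"
proof -
  let ?y = "x[a := flip (x ! a)]"
  have "incidence ?y (?y[a := Star]) = coord_incidence ?y a"
    using assms flip_not_Star by (intro incidence_update) simp_all
  moreover have "coord_incidence ?y a = - coord_incidence x a"
    using assms by (cases "x ! a") (simp_all add: coord_incidence_def flip_def)
  ultimately show ?thesis
    using assms by (simp add: incidence_update)
qed

lemma coord_incidence_update:
  assumes "a < length x" "b < length x" "a \<noteq> b" "x ! a \<noteq> Star" "x ! b \<noteq> Star"
  shows "coord_incidence (x[a := Star]) b = (if a < b then -1 else 1) * coord_incidence x b"
proof (cases "a < b")
  case True
  have "take b (x[a := Star]) = (take b x)[a := Star]"
    by (simp add: take_update_swap)
  then have "st (take b (x[a := Star])) = Suc (st (take b x))"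
    using True assms by (simp add: st_update_Star)
  then show ?thesis
    using True assms by (simp add: coord_incidence_def)
next
  case False
  then have "take b (x[a := Star]) = take b x" by simp
  then show ?thesis
    using False assms by (simp add: coord_incidence_def)
qed

text \<open>Two coordinates can be starred in two orders, and the later one in the coordinate order
  sees one more star if it comes second: the signs of the two paths are opposite.\<close>

lemma incidence_diamond:
  assumes "a < length x" "b < length x" "a \<noteq> b" "x ! a \<noteq> Star" "x ! b \<noteq> Star"
  shows "incidence x (x[b := Star]) * incidence (x[b := Star]) (x[a := Star, b := Star]) =
    - (incidence x (x[a := Star]) * incidence (x[a := Star]) (x[a := Star, b := Star]))"
proof -
  have "incidence (x[a := Star]) (x[a := Star, b := Star]) = coord_incidence (x[a := Star]) b"
    using assms by (intro incidence_update) auto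
  moreover have "incidence (x[b := Star]) (x[b := Star, a := Star]) = coord_incidence (x[b := Star]) a"
    using assms by (intro incidence_update) auto
  moreover have "x[a := Star, b := Star] = x[b := Star, a := Star]"
    using assms(3) by (rule list_update_swap)
  ultimately show ?thesis
    using assms by (simp add: incidence_update coord_incidence_update)
qed

text \<open>The coefficient of a maximal chain in the fundamental cycle. The two copies of the top
  have second coordinates \<open>bars \<sigma> n\<close> and \<open>bars \<sigma> n + 1\<close>.\<close>

definition chain_sign :: "nat \<Rightarrow> letter list \<Rightarrow> rees list \<Rightarrow> int" where
  "chain_sign n \<sigma> xs = (\<Prod>k<n. incidence (face_of (xs ! k)) (face_of (xs ! Suc k))) *
    (if level_of (xs ! n) = bars \<sigma> n then 1 else -1)"

lemma abs_chain_sign: "\<bar>chain_sign n \<sigma> xs\<bar> = 1"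
proof -
  have "\<bar>\<Prod>k\<in>K. incidence (f k) (g k)\<bar> = 1" for K :: "nat set" and f g
    by (induction K rule: infinite_finite_induct) (simp_all add: abs_mult abs_incidence)
  then show ?thesis by (simp add: chain_sign_def abs_mult)
qed

context
  fixes n :: nat and \<sigma> :: "letter list"
  assumes n_pos: "1 \<le> n" and falling: "\<sigma> \<in> falling_words n"
begin

text \<open>The pseudomanifold property with orientation: a maximal chain has exactly one other filling at
  each rank, and it has the opposite sign. At the top rank it is the other copy of the top face, at rank
  0 the other vertex of the edge, and in between the face that stars the next two coordinates of the chain
  in the other order.\<close>

lemma other_filling:
  assumes xs: "xs \<in> simplices (sphere n \<sigma>) rees_le n" and "k \<le> n"
  obtains e' where "e' \<noteq> xs ! k" "xs[k := e'] \<in> simplices (sphere n \<sigma>) rees_le n"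
    "chain_sign n \<sigma> (xs[k := e']) = - chain_sign n \<sigma> xs"
    "\<And>e. xs[k := e] \<in> simplices (sphere n \<sigma>) rees_le n \<Longrightarrow> e = xs ! k \<or> e = e'"
proof -
  note mem_iff = in_sphere_iff[OF n_pos falling]
  note chain_iff = sphere_chain_iff[OF n_pos falling]
  define X where "X i = face_of (xs ! i)" for i
  have len: "length xs = Suc n" and mem: "\<And>i. i \<le> n \<Longrightarrow> xs ! i \<in> sphere n \<sigma>"
    and st_X: "\<And>i. i \<le> n \<Longrightarrow> st (X i) = i" and le_X: "\<And>i. i < n \<Longrightarrow> face_le (X i) (X (Suc i))"
    using xs unfolding chain_iff X_def by auto
  have sphereE: "\<exists>x j. e = Elem (x, j)" if "e \<in> sphere n \<sigma>" for e
    using that by (auto simp: sphere_def)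
  have len_X: "length (X i) = n" if "i \<le> n" for i
    using mem[OF that] sphereE[OF mem[OF that]] mem_iff by (auto simp: X_def)
  \<comment> \<open>below the top rank an element of the sphere is determined by its face\<close>
  have eqI: "e = e'" if "e \<in> sphere n \<sigma>" "e' \<in> sphere n \<sigma>" "face_of e = face_of e'" "rank_of e < n"
    for e e'
    using sphereE[OF that(1)] sphereE[OF that(2)] that mem_iff by auto
  have update_iff: "xs[k := e] \<in> simplices (sphere n \<sigma>) rees_le n \<longleftrightarrow>
      e \<in> sphere n \<sigma> \<and> rank_of e = k \<and> (k < n \<longrightarrow> face_le (face_of e) (X (Suc k))) \<and>
      (\<forall>p. k = Suc p \<longrightarrow> face_le (X p) (face_of e))" for e
  proof -
    have "xs[k := e] ! i = (if i = k then e else xs ! i)" if "i \<le> n" for i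
      using that len by auto
    then have eq: "xs[k := e] \<in> simplices (sphere n \<sigma>) rees_le n \<longleftrightarrow>
      (\<forall>i\<le>n. i = k \<longrightarrow> e \<in> sphere n \<sigma> \<and> rank_of e = k) \<and>
      (\<forall>i<n. face_le (if i = k then face_of e else X i) (if Suc i = k then face_of e else X (Suc i)))"
      unfolding chain_iff using len mem st_X by (auto simp: X_def)
    have "(\<forall>i<n. face_le (if i = k then face_of e else X i)
          (if Suc i = k then face_of e else X (Suc i))) \<longleftrightarrow>
        (k < n \<longrightarrow> face_le (face_of e) (X (Suc k))) \<and>
        (\<forall>p. k = Suc p \<longrightarrow> face_le (X p) (face_of e))" (is "?L \<longleftrightarrow> ?R1 \<and> ?R2")
    proof (intro iffI conjI)
      assume L: ?L
      show ?R1 using L by fastforce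
      show ?R2
      proof (intro allI impI)
        fix p assume "k = Suc p"
        then show "face_le (X p) (face_of e)" using L[rule_format, of p] \<open>k \<le> n\<close> by simp
      qed
    next
      assume R: "?R1 \<and> ?R2"
      show ?L
      proof (intro allI impI)
        fix i assume "i < n"
        then show "face_le (if i = k then face_of e else X i)
            (if Suc i = k then face_of e else X (Suc i))"
          using R le_X[of i] by auto
      qed
    qed
    then show ?thesis
      unfolding eq using \<open>k \<le> n\<close> by simp
  qed
  show thesis
  proof (cases "k = n")
    case True
    have full: "X n = replicate n Star"
      using st_eq_length_iff[of "X n"] st_X[of n] len_X[of n] by simp
    obtain j where j: "xs ! n = Elem (X n, j)"
      using sphereE[OF mem[of n]] by (auto simp: X_def)
    have level: "level_of (xs ! n) = j"
      by (simp add: j)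
    have j_cases: "j = bars \<sigma> n \<or> j = Suc (bars \<sigma> n)"
      using mem[of n] j mem_iff st_X[of n] by simp
    define j' where "j' = (if j = bars \<sigma> n then Suc (bars \<sigma> n) else bars \<sigma> n)"
    define e' where "e' = Elem (X n, j')"
    have e'_mem: "e' \<in> sphere n \<sigma>"
      using mem_iff len_X[of n] st_X[of n] by (simp add: e'_def j'_def)
    show thesis
    proof
      show "e' \<noteq> xs ! k" using True j j_cases by (auto simp: e'_def j'_def)
      show "xs[k := e'] \<in> simplices (sphere n \<sigma>) rees_le n"
        unfolding update_iff using e'_mem True st_X[of n] le_X by (auto simp: e'_def)
      have "face_of (xs[k := e'] ! i) = X i" if "i \<le> n" for i
        using that True len by (cases "i = n") (simp_all add: X_def e'_def)
      then have "(\<Prod>i<n. incidence (face_of (xs[k := e'] ! i)) (face_of (xs[k := e'] ! Suc i))) =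
          (\<Prod>i<n. incidence (X i) (X (Suc i)))"
        by (intro prod.cong refl) simp
      moreover have "level_of (xs[k := e'] ! n) = j'"
        using True len by (simp add: e'_def)
      ultimately show "chain_sign n \<sigma> (xs[k := e']) = - chain_sign n \<sigma> xs"
        using j_cases level by (auto simp: chain_sign_def X_def j'_def)
      show "e = xs ! k \<or> e = e'" if "xs[k := e] \<in> simplices (sphere n \<sigma>) rees_le n" for e
      proof -
        have e: "e \<in> sphere n \<sigma>" "rank_of e = n" using that True update_iff by auto
        obtain x l where x: "e = Elem (x, l)" using sphereE[OF e(1)] by auto
        then have "x = X n" "l = bars \<sigma> n \<or> l = Suc (bars \<sigma> n)"
          using e mem_iff st_eq_length_iff[of x] full by auto
        then show ?thesis using x True j j_cases by (auto simp: e'_def j'_def)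
      qed
    qed
  next
    case False
    then have "k < n" using \<open>k \<le> n\<close> by simp
    have level_unique: thesis
      if y: "length y = n" "st y = k" "y \<noteq> X k" "face_le y (X (Suc k))"
        "\<And>p. k = Suc p \<Longrightarrow> face_le (X p) y"
        and sign: "(\<Prod>i<n. incidence (if i = k then y else X i) (if Suc i = k then y else X (Suc i))) =
          - (\<Prod>i<n. incidence (X i) (X (Suc i)))"
        and uniq: "\<And>x. \<lbrakk>length x = n; st x = k; face_le x (X (Suc k));
          \<And>p. k = Suc p \<Longrightarrow> face_le (X p) x\<rbrakk> \<Longrightarrow> x = X k \<or> x = y" for y
    proof -
      define e' where "e' = Elem (y, sphere_level n \<sigma> k y)"
      have e'_mem: "e' \<in> sphere n \<sigma>"
        using mem_iff y \<open>k < n\<close> by (simp add: e'_def)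
      show thesis
      proof
        have "face_of e' \<noteq> face_of (xs ! k)" using y(3) by (simp add: e'_def X_def)
        then show "e' \<noteq> xs ! k" by blast
        show "xs[k := e'] \<in> simplices (sphere n \<sigma>) rees_le n"
          unfolding update_iff using e'_mem y by (auto simp: e'_def)
        have nth: "face_of (xs[k := e'] ! i) = (if i = k then y else X i)" if "i \<le> n" for i
          using that len by (cases "i = k") (simp_all add: e'_def X_def)
        have "(\<Prod>i<n. incidence (face_of (xs[k := e'] ! i)) (face_of (xs[k := e'] ! Suc i))) =
            (\<Prod>i<n. incidence (if i = k then y else X i) (if Suc i = k then y else X (Suc i)))"
          by (intro prod.cong refl) (simp add: nth)
        then show "chain_sign n \<sigma> (xs[k := e']) = - chain_sign n \<sigma> xs"
          using sign \<open>k < n\<close> by (simp add: chain_sign_def X_def)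
        show "e = xs ! k \<or> e = e'" if "xs[k := e] \<in> simplices (sphere n \<sigma>) rees_le n" for e
        proof -
          have e: "e \<in> sphere n \<sigma>" "rank_of e = k" "face_le (face_of e) (X (Suc k))"
            "\<And>p. k = Suc p \<Longrightarrow> face_le (X p) (face_of e)"
            using that \<open>k < n\<close> update_iff by auto
          have "length (face_of e) = n"
            using e(3) len_X[of "Suc k"] \<open>k < n\<close> length_face_le by simp
          then have "face_of e = X k \<or> face_of e = y"
            using uniq e by blast
          then show ?thesis
          proof
            assume "face_of e = X k"
            then show ?thesis
              using eqI[OF e(1) mem[OF \<open>k \<le> n\<close>]] e(2) \<open>k < n\<close> by (simp add: X_def)
          next
            assume "face_of e = y"
            then show ?thesis
              using eqI[OF e(1) e'_mem] e(2) \<open>k < n\<close> by (simp add: e'_def)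
          qed
        qed
      qed
    qed
    show thesis
    proof (cases k)
      case 0
      have "face_le (X 0) (X 1)" "st (X 1) = Suc (st (X 0))"
        using le_X[of 0] st_X[of 0] st_X[of 1] n_pos by simp_all
      then obtain a where "a < length (X 0)" and a: "X 0 ! a \<noteq> Star" "X 1 = (X 0)[a := Star]"
        by (rule face_cover)
      note len0 = \<open>a < length (X 0)\<close>
      define y where "y = (X 0)[a := flip (X 0 ! a)]"
      show thesis
      proof (rule level_unique[of y])
        show "length y = n" using len_X[of 0] by (simp add: y_def)
        show "st y = k"
          using a flip_not_Star len0 0 st_X[of 0] by (simp add: y_def st_update_not_Star)
        show "y \<noteq> X k"
          using 0 flip_neq[OF a(1)] len0 unfolding y_def by (metis nth_list_update_eq)
        have X1: "X 1 = y[a := Star]" using a(2) by (simp add: y_def)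
        show "face_le y (X (Suc k))"
          using 0 face_le_update[of a y] X1 len0 by (simp add: y_def)
        show "face_le (X p) y" if "k = Suc p" for p using that 0 by simp
        have flip_sign: "incidence y (X 1) = - incidence (X 0) (X 1)"
          using incidence_flip[OF len0 a(1)] a(2) by (simp add: y_def)
        have split: "prod f {..<n} = f 0 * prod f ({..<n} - {0})" for f :: "nat \<Rightarrow> int"
          using n_pos by (simp add: prod.remove)
        have rest: "(\<Prod>i\<in>{..<n} - {0}.
              incidence (if i = k then y else X i) (if Suc i = k then y else X (Suc i))) =
            (\<Prod>i\<in>{..<n} - {0}. incidence (X i) (X (Suc i)))"
          by (rule prod.cong) (auto simp: 0)
        show "(\<Prod>i<n. incidence (if i = k then y else X i) (if Suc i = k then y else X (Suc i))) =
          - (\<Prod>i<n. incidence (X i) (X (Suc i)))"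
          using flip_sign by (simp only: split rest) (simp add: 0)
        show "x = X k \<or> x = y" if x: "length x = n" "st x = k" "face_le x (X (Suc k))" for x
        proof -
          have "face_le x (X 1)" "st (X 1) = Suc (st x)"
            using x 0 st_X[of 1] n_pos by simp_all
          then obtain b where blen: "b < length x" and b: "x ! b \<noteq> Star" "X 1 = x[b := Star]"
            by (rule face_cover)
          have "a = b"
          proof (rule ccontr)
            assume "a \<noteq> b"
            then have "X 0 ! b = Star"
              using arg_cong[OF b(2), of "\<lambda>z. z ! b"] a(2) blen by simp
            then show False
              using st_X[of 0] blen x(1) len_X[of 0] by (simp add: st_eq_0_iff)
          qed
          then have eq: "x = (X 0)[a := x ! a]"
            using a(2) b(2) by (metis list_update_id list_update_overwrite)
          show ?thesis
          proof (cases "x ! a = X 0 ! a")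
            case True
            then show ?thesis using eq 0 by simp
          next
            case False
            then have "x ! a = flip (X 0 ! a)"
              using flip_cases a(1) b(1) \<open>a = b\<close> by simp
            then show ?thesis using eq by (simp add: y_def)
          qed
        qed
      qed
    next
      case (Suc p)
      have p: "p < n" "Suc p < n" using Suc \<open>k < n\<close> by auto
      have "face_le (X p) (X k)" "st (X k) = Suc (st (X p))"
        using le_X[OF p(1)] st_X[of p] st_X[of "Suc p"] p Suc by simp_all
      then obtain a where a: "a < length (X p)" "X p ! a \<noteq> Star" "X k = (X p)[a := Star]"
        by (rule face_cover)
      have "face_le (X k) (X (Suc k))" "st (X (Suc k)) = Suc (st (X k))"
        using le_X[OF p(2)] st_X[of "Suc p"] st_X[of "Suc (Suc p)"] p Suc by simp_all
      then obtain b where b: "b < length (X k)" "X k ! b \<noteq> Star" "X (Suc k) = (X k)[b := Star]"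
        by (rule face_cover)
      have lens: "a < length (X p)" "b < length (X p)" using a b by simp_all
      have "a \<noteq> b" using a(3) b(2) lens by auto
      then have b': "X p ! b \<noteq> Star" using a(3) b(2) by simp
      define y where "y = (X p)[b := Star]"
      have top: "X (Suc k) = (X p)[a := Star, b := Star]" using a(3) b(3) by simp
      then have top': "X (Suc k) = y[a := Star]"
        using list_update_swap[OF \<open>a \<noteq> b\<close>] by (simp add: y_def)
      show thesis
      proof (rule level_unique[of y])
        show "length y = n" using len_X[of p] p by (simp add: y_def)
        show "st y = k"
          using lens b' st_X[of p] p Suc by (simp add: y_def st_update_Star)
        have "X k ! a = Star" "y ! a \<noteq> Star"
          using a lens \<open>a \<noteq> b\<close> by (simp_all add: y_def)
        then show "y \<noteq> X k" by auto
        show "face_le y (X (Suc k))"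
          using face_le_update[of a y] top' lens by (simp add: y_def)
        show "face_le (X q) y" if "k = Suc q" for q
          using that Suc face_le_update[of b "X p"] lens by (simp add: y_def)
        have diamond: "incidence (X p) y * incidence y (X (Suc (Suc p))) =
            - (incidence (X p) (X (Suc p)) * incidence (X (Suc p)) (X (Suc (Suc p))))"
          using incidence_diamond[OF lens \<open>a \<noteq> b\<close> a(2) b'] a(3) top Suc by (simp add: y_def)
        have split: "prod f {..<n} = f p * (f (Suc p) * prod f ({..<n} - {p, Suc p}))"
          for f :: "nat \<Rightarrow> int"
        proof -
          have "{..<n} = insert p (insert (Suc p) ({..<n} - {p, Suc p}))" using p by auto
          from arg_cong[OF this, of "prod f"] show ?thesis by simp
        qed
        have rest: "(\<Prod>i\<in>{..<n} - {p, Suc p}.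
              incidence (if i = k then y else X i) (if Suc i = k then y else X (Suc i))) =
            (\<Prod>i\<in>{..<n} - {p, Suc p}. incidence (X i) (X (Suc i)))"
          by (rule prod.cong) (auto simp: Suc)
        show "(\<Prod>i<n. incidence (if i = k then y else X i) (if Suc i = k then y else X (Suc i))) =
          - (\<Prod>i<n. incidence (X i) (X (Suc i)))"
          using diamond by (simp only: split rest) (simp add: Suc mult.assoc[symmetric])
        show "x = X k \<or> x = y"
          if x: "length x = n" "st x = k" "face_le x (X (Suc k))" "\<And>q. k = Suc q \<Longrightarrow> face_le (X q) x" for x
        proof -
          have "face_le (X p) x" "st x = Suc (st (X p))"
            using x Suc st_X[of p] p by simp_all
          then obtain c where c: "c < length (X p)" "X p ! c \<noteq> Star" "x = (X p)[c := Star]"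
            by (rule face_cover)
          have "x ! c = Star" "c < length x" using c by simp_all
          then have "X (Suc k) ! c = Star"
            using x(3) by (metis face_le_iff)
          then have "c = a \<or> c = b"
            using top c(2) by (metis nth_list_update_neq)
          then show ?thesis using c(3) a(3) by (auto simp: y_def)
        qed
      qed
    qed
  qed
qed

interpretation sphere: graded "sphere n \<sigma>" rees_le rank_of n
  by (rule graded_subset_proper_part) (rule sphere_subset_proper_part[OF n_pos falling])

lemma unit_cycle_exists:
  obtains z where "z \<in> cycles (sphere n \<sigma>) rees_le n" "\<bar>lookup z (word_chain n \<sigma>)\<bar> = 1"
proof -
  define S where "S = simplices (sphere n \<sigma>) rees_le n"
  have "S \<subseteq> {xs. set xs \<subseteq> sphere n \<sigma> \<and> length xs = Suc n}"
    by (auto simp: S_def simplices_def)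
  then have fin: "finite S"
    using finite_lists_length_eq[OF sphere.finite_carrier] finite_subset by blast
  define z where "z = Abs_poly_mapping (\<lambda>xs. if xs \<in> S then chain_sign n \<sigma> xs else 0)"
  have z: "lookup z xs = (if xs \<in> S then chain_sign n \<sigma> xs else 0)" for xs
    unfolding z_def using fin by (subst lookup_Abs_poly_mapping) auto
  have "z \<in> cycles (sphere n \<sigma>) rees_le n"
    unfolding sphere.cycles_iff
  proof (intro conjI ballI allI impI)
    show "keys z \<subseteq> simplices (sphere n \<sigma>) rees_le n"
      using z by (auto simp: in_keys_iff S_def split: if_splits)
    fix xs k assume xs: "xs \<in> simplices (sphere n \<sigma>) rees_le n" and "k \<le> n"
    obtain e' where e': "e' \<noteq> xs ! k" "xs[k := e'] \<in> simplices (sphere n \<sigma>) rees_le n"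
      "chain_sign n \<sigma> (xs[k := e']) = - chain_sign n \<sigma> xs"
      "\<And>e. xs[k := e] \<in> simplices (sphere n \<sigma>) rees_le n \<Longrightarrow> e = xs ! k \<or> e = e'"
      using other_filling[OF xs \<open>k \<le> n\<close>] by metis
    have "length xs = Suc n" using xs by (simp add: simplices_def)
    then have "e' \<in> sphere n \<sigma>"
      using simplices_nth(1)[OF e'(2) \<open>k \<le> n\<close>] \<open>k \<le> n\<close> by simp
    then have "(\<Sum>e\<in>sphere n \<sigma>. lookup z (xs[k := e])) = (\<Sum>e\<in>{xs ! k, e'}. lookup z (xs[k := e]))"
      using sphere.finite_carrier simplices_nth(1)[OF xs \<open>k \<le> n\<close>] e'(4)
      by (intro sum.mono_neutral_right) (auto simp: z S_def)
    also have "\<dots> = 0"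
      using e' xs by (simp add: z S_def)
    finally show "(\<Sum>e\<in>sphere n \<sigma>. lookup z (xs[k := e])) = 0" .
  qed
  moreover have "\<bar>lookup z (word_chain n \<sigma>)\<bar> = 1"
    using word_chain_in_sphere[OF n_pos falling] by (simp add: z S_def abs_chain_sign)
  ultimately show thesis by (rule that)
qed

text \<open>The cycle with coefficients \<open>chain_sign\<close> is an integer multiple of \<open>w\<close>, so the value of \<open>w\<close>
  divides \<open>\<plusminus>1\<close>.\<close>

lemma fundamental_cycle_unit:
  assumes "fundamental_cycle (sphere n \<sigma>) rees_le n w"
  shows "\<bar>lookup w (word_chain n \<sigma>)\<bar> = 1"
proof -
  obtain z where z: "z \<in> cycles (sphere n \<sigma>) rees_le n" "\<bar>lookup z (word_chain n \<sigma>)\<bar> = 1"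
    by (rule unit_cycle_exists)
  obtain k where "z = frag_cmul k w"
    using sphere.fundamental_cycle_multiple[OF assms z(1)] .
  then have "\<bar>lookup w (word_chain n \<sigma>) * k\<bar> = 1"
    using z(2) by (simp add: mult.commute)
  then show ?thesis
    by (rule abs_zmult_eq_1)
qed

lemma sphere_cycle_in_proper_part:
  "w \<in> cycles (sphere n \<sigma>) rees_le n \<Longrightarrow> w \<in> cycles (proper_part n) rees_le n"
  using sphere_subset_proper_part[OF n_pos falling]
  by (auto simp: cycles_def chain_group_def simplices_def)

end

section \<open>Falling chains inside the sphere of a falling word\<close>

lemma descents_imp_le:
  assumes "a \<le> b" "\<And>s. \<lbrakk>a \<le> s; s < b\<rbrakk> \<Longrightarrow> descent \<sigma> s"
  shows "fst (\<sigma> ! b) + int b \<le> fst (\<sigma> ! a) + int a"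
  using assms
proof (induction b rule: dec_induct)
  case (step s)
  then have "descent \<sigma> s" "fst (\<sigma> ! s) + int s \<le> fst (\<sigma> ! a) + int a" by simp_all
  then show ?case by (simp add: descent_def)
qed simp

text \<open>Compare two falling words at the first position \<open>t\<close> where they may differ, assuming that they
  have the same bar drops and the same faces there. Let \<open>q\<close> be the first bar drop of \<open>\<sigma>\<close> from \<open>t\<close> on (or
  \<open>n\<close>). Both chains have the same stars at rank \<open>q\<close>, so the letter of \<open>\<tau>\<close> at \<open>t\<close> occurs in \<open>\<sigma>\<close> at some
  \<open>u\<close> between \<open>t\<close> and \<open>q\<close>, up to sign. The signs agree: after an earlier bar drop they can be
  read off from the common face there, and before the first bar drop all letters are negative, since
  the word descends from the letter 0. As \<open>\<sigma>\<close> decreases from \<open>t\<close> to \<open>q\<close>, its letter at \<open>u\<close>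
  is at most that at \<open>t\<close>.\<close>

lemma letter_le:
  assumes \<sigma>: "\<sigma> \<in> falling_words n" and \<tau>: "\<tau> \<in> falling_words n"
    and drops: "\<And>i. i \<le> n \<Longrightarrow> bar_drop \<tau> i \<longleftrightarrow> bar_drop \<sigma> i"
    and faces: "\<And>i. \<lbrakk>i < n; bar_drop \<sigma> i\<rbrakk> \<Longrightarrow> fst (m_chain n \<tau> i) = fst (m_chain n \<sigma> i)"
    and t: "1 \<le> t" "t \<le> n"
    and before: "\<And>s. \<lbrakk>1 \<le> s; s < t\<rbrakk> \<Longrightarrow> \<tau> ! s = \<sigma> ! s"
  shows "fst (\<tau> ! t) \<le> fst (\<sigma> ! t)"
proof -
  have words: "\<sigma> \<in> barred_words n" "\<tau> \<in> barred_words n"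
    using \<sigma> \<tau> falling_words_iff by blast+
  define q where "q = (LEAST q. t \<le> q \<and> (q = n \<or> bar_drop \<sigma> q))"
  have q: "t \<le> q" "q = n \<or> bar_drop \<sigma> q"
    using LeastI[of "\<lambda>q. t \<le> q \<and> (q = n \<or> bar_drop \<sigma> q)" n] t by (auto simp: q_def)
  have "q \<le> n"
    unfolding q_def using t by (intro Least_le) simp
  have run: "descent \<sigma> s" if "t \<le> s" "s < q" for s
  proof -
    have "\<not> bar_drop \<sigma> s"
      using not_less_Least[of s "\<lambda>q. t \<le> q \<and> (q = n \<or> bar_drop \<sigma> q)"] that by (auto simp: q_def)
    moreover have "s \<le> n" using that \<open>q \<le> n\<close> by simp
    ultimately show ?thesis
      using \<sigma> falling_words_iff by blast
  qed
  have t_in: "t \<in> {1..n}" using t by simp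
  define a where "a = letter_index \<tau> t - 1"
  have a: "a < n" "Suc a = letter_index \<tau> t"
    using letter_index_bounds[OF words(2) t_in] by (auto simp: a_def)
  have "Suc a \<in> letter_index \<sigma> ` {1..q}"
  proof (cases "q = n")
    case True
    then show ?thesis
      using bij_letter_index[OF words(1)] a(1) by (simp add: bij_betw_def)
  next
    case False
    then have "fst (m_chain n \<tau> q) = fst (m_chain n \<sigma> q)"
      using faces q(2) \<open>q \<le> n\<close> by simp
    moreover have "Suc a \<in> letter_index \<tau> ` {1..q}"
      unfolding a(2) using q(1) t(1) by simp
    ultimately show ?thesis
      using nth_m_chain_eq_Star_iff[OF words(1) a(1) \<open>q \<le> n\<close>]
        nth_m_chain_eq_Star_iff[OF words(2) a(1) \<open>q \<le> n\<close>] by simp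
  qed
  then obtain u where u: "u \<in> {1..q}" "letter_index \<sigma> u = Suc a"
    by (metis imageE)
  have "t \<le> u"
  proof (rule ccontr)
    assume "\<not> t \<le> u"
    then have "letter_index \<tau> u = letter_index \<tau> t"
      using before[of u] u a(2) by (simp add: letter_index_def)
    then show False
      using letter_index_eq_iff[OF words(2), of u t] t u(1) \<open>\<not> t \<le> u\<close> by auto
  qed
  have "fst (\<sigma> ! u) = fst (\<tau> ! t)"
  proof (cases "\<exists>p<t. bar_drop \<sigma> p")
    case True
    then obtain p where p: "p < t" "bar_drop \<sigma> p" by blast
    have "coord_value (fst (m_chain n \<tau> p)) a = fst (\<tau> ! t)"
      using letter_coord(3)[OF words(2) p(1) t(2)] by (simp add: a_def)
    moreover have "coord_value (fst (m_chain n \<sigma> p)) a = fst (\<sigma> ! u)"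
      using letter_coord(3)[OF words(1), of p u] p(1) \<open>t \<le> u\<close> u \<open>q \<le> n\<close> by simp
    ultimately show ?thesis
      using faces[of p] p t(2) by simp
  next
    case False
    have initial: "descent \<tau> s \<and> descent \<sigma> s" if "s < t" for s
    proof -
      have "s \<le> n" using that t(2) by simp
      then show ?thesis
        using False \<sigma> \<tau> drops[of s] that falling_words_iff by blast
    qed
    have "fst (\<tau> ! t) + int t \<le> fst (\<tau> ! 0) + int 0"
      using initial by (intro descents_imp_le) auto
    then have "fst (\<tau> ! t) < 0"
      using words(2) t(1) by (simp add: barred_words_def)
    moreover have "descent \<sigma> s" if "s < u" for s
    proof (cases "s < t")
      case True
      then show ?thesis using initial by simp
    next
      case False
      then show ?thesis using run that u(1) by simp
    qed
    then have "fst (\<sigma> ! u) + int u \<le> fst (\<sigma> ! 0) + int 0"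
      by (intro descents_imp_le) auto
    then have "fst (\<sigma> ! u) < 0"
      using words(1) u(1) by (simp add: barred_words_def)
    ultimately show ?thesis
      using u(2) a(2) by (simp add: letter_index_def)
  qed
  moreover have "fst (\<sigma> ! u) + int u \<le> fst (\<sigma> ! t) + int t"
    using \<open>t \<le> u\<close> run u(1) by (intro descents_imp_le) auto
  ultimately show ?thesis
    using \<open>t \<le> u\<close> by simp
qed

text \<open>The hypotheses of \<open>letter_le\<close> are symmetric in the two words, so both inequalities hold, and
  the words agree by induction on the position.\<close>

lemma falling_word_unique:
  assumes \<sigma>: "\<sigma> \<in> falling_words n" and \<tau>: "\<tau> \<in> falling_words n"
    and bars_eq: "\<And>i. i \<le> n \<Longrightarrow> bars \<tau> i = bars \<sigma> i"
    and faces: "\<And>i. \<lbrakk>i < n; bar_drop \<sigma> i\<rbrakk> \<Longrightarrow> fst (m_chain n \<tau> i) = fst (m_chain n \<sigma> i)"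
  shows "\<tau> = \<sigma>"
proof -
  have words: "\<sigma> \<in> barred_words n" "\<tau> \<in> barred_words n"
    using \<sigma> \<tau> falling_words_iff by blast+
  have ends: "\<tau> ! 0 = \<sigma> ! 0" "\<tau> ! Suc n = \<sigma> ! Suc n" "length \<tau> = length \<sigma>" "length \<sigma> = n + 2"
    using words by (simp_all add: barred_words_def)
  have barred: "barred \<tau> i = barred \<sigma> i" if "i \<le> Suc n" for i
  proof (cases "i = 0 \<or> i = Suc n")
    case True
    then show ?thesis using ends by auto
  next
    case False
    then obtain p where "i = Suc p" by (cases i) auto
    moreover have "i \<le> n" using False that by simp
    ultimately show ?thesis
      using bars_eq[of p] bars_eq[of i] by (simp add: bars_Suc of_bool_eq_iff)
  qed
  then have drops: "bar_drop \<tau> i \<longleftrightarrow> bar_drop \<sigma> i" if "i \<le> n" for i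
    using that by (simp add: bar_drop_def)
  have inner: "\<tau> ! t = \<sigma> ! t" if "1 \<le> t" "t \<le> n" for t
    using that
  proof (induction t rule: less_induct)
    case (less t)
    then have before: "\<tau> ! s = \<sigma> ! s" if "1 \<le> s" "s < t" for s
      using that by simp
    have "fst (\<tau> ! t) \<le> fst (\<sigma> ! t)"
      by (rule letter_le[OF \<sigma> \<tau> drops faces less.prems before])
    moreover have "fst (\<sigma> ! t) \<le> fst (\<tau> ! t)"
      by (rule letter_le[OF \<tau> \<sigma>]) (use drops faces less.prems before in simp_all)
    ultimately show ?case
      using barred[of t] less.prems by (simp add: prod_eq_iff)
  qed
  show ?thesis
  proof (rule nth_equalityI)
    fix i assume "i < length \<tau>"
    then consider "i = 0" | "1 \<le> i" "i \<le> n" | "i = Suc n" using ends by linarith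
    then show "\<tau> ! i = \<sigma> ! i" using ends inner by cases auto
  qed (use ends in simp)
qed

text \<open>A bar at position \<open>t\<close> contributes \<open>n + 1 - t\<close>, so the weight decreases when bars move to the
  right.\<close>

definition bar_weight :: "nat \<Rightarrow> letter list \<Rightarrow> nat" where
  "bar_weight n \<sigma> = (\<Sum>i\<le>n. bars \<sigma> i)"

text \<open>In the sphere of \<open>\<sigma>\<close> the second coordinate of a face is at most that of the element of
  \<open>m_chain n \<sigma>\<close> of the same rank below rank \<open>n\<close>, and at a bar drop of \<open>\<sigma>\<close> equality forces the face to be the one in that
  chain. At rank \<open>n\<close> both chains raise the second coordinate, because the last letter of a falling word is
  barred.\<close>

lemma falling_chain_in_sphere:
  assumes "1 \<le> n" and \<sigma>: "\<sigma> \<in> falling_words n" and \<tau>: "\<tau> \<in> falling_words n"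
    and mem: "word_chain n \<tau> \<in> simplices (sphere n \<sigma>) rees_le n"
  shows "\<sigma> = \<tau> \<or> bar_weight n \<tau> < bar_weight n \<sigma>"
proof -
  have word: "\<tau> \<in> barred_words n" using \<tau> falling_words_iff by blast
  have level: "Suc (bars \<tau> i) = sphere_level n \<sigma> i (fst (m_chain n \<tau> i))" if "i < n" for i
  proof -
    have "Elem (m_chain n \<tau> i) \<in> sphere n \<sigma>"
      using simplices_nth(1)[OF mem, of i] that by (simp add: nth_word_chain)
    then have "Elem (fst (m_chain n \<tau> i), snd (m_chain n \<tau> i)) \<in> sphere n \<sigma>" by simp
    then show ?thesis
      using in_sphere_iff[OF \<open>1 \<le> n\<close> \<sigma>] st_m_chain[OF word, of i] that by (simp add: snd_m_chain)
  qed
  obtain p where p: "Suc p = n" using \<open>1 \<le> n\<close> by (cases n) auto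
  have lower: "bars \<tau> i \<le> bars \<sigma> i" if "i < n" for i
    using level[OF that] by (simp add: sphere_level_def split: if_splits)
  then have bars_le': "bars \<tau> i \<le> bars \<sigma> i" if "i \<le> n" for i
    using that p bars_last[OF \<open>1 \<le> n\<close> \<sigma> p] bars_last[OF \<open>1 \<le> n\<close> \<tau> p]
    by (cases "i = n") auto
  show ?thesis
  proof (cases "\<forall>i\<le>n. bars \<tau> i = bars \<sigma> i")
    case True
    have "\<tau> = \<sigma>"
    proof (rule falling_word_unique[OF \<sigma> \<tau>])
      show "fst (m_chain n \<tau> i) = fst (m_chain n \<sigma> i)" if "i < n" "bar_drop \<sigma> i" for i
        using level[of i] that True by (simp add: sphere_level_def split: if_splits)
    qed (use True in simp)
    then show ?thesis by simp
  next
    case False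
    then obtain i where "i \<le> n" "bars \<tau> i < bars \<sigma> i"
      using bars_le' le_neq_implies_less by blast
    then have "bar_weight n \<tau> < bar_weight n \<sigma>"
      unfolding bar_weight_def using bars_le' by (intro sum_strict_mono_ex1) auto
    then show ?thesis by simp
  qed
qed

lemma finite_falling_words: "finite (falling_words n)"
proof (rule finite_subset)
  let ?L = "{- int (n + 1)..int (n + 1)} \<times> (UNIV :: bool set)"
  show "falling_words n \<subseteq> {\<sigma>. set \<sigma> \<subseteq> ?L \<and> length \<sigma> = n + 2}"
  proof
    fix \<sigma> assume \<sigma>: "\<sigma> \<in> falling_words n"
    then have word: "\<sigma> \<in> barred_words n" using falling_words_iff by blast
    have "fst (\<sigma> ! i) \<in> {- int (n + 1)..int (n + 1)}" if i: "i < n + 2" for i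
    proof -
      consider "i = 0" | "1 \<le> i" "i \<le> n" | "i = n + 1" using i by linarith
      then show ?thesis
      proof cases
        case 2
        then show ?thesis
          using letter_index_bounds[OF word, of i] by (auto simp: letter_index_def)
      qed (use word in \<open>auto simp: barred_words_def\<close>)
    qed
    moreover have "length \<sigma> = n + 2" using word by (simp add: barred_words_def)
    ultimately show "\<sigma> \<in> {\<sigma>. set \<sigma> \<subseteq> ?L \<and> length \<sigma> = n + 2}"
      by (auto simp: in_set_conv_nth) (metis atLeastAtMost_iff fst_conv)+
  qed
  show "finite {\<sigma>. set \<sigma> \<subseteq> ?L \<and> length \<sigma> = n + 2}"
    by (rule finite_lists_length_eq) simp
qed

section \<open>The basis theorem\<close>

theorem theorem7p5:
  fixes n :: nat and \<rho> :: "letter list \<Rightarrow> (rees list \<Rightarrow>\<^sub>0 int)"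
  assumes "n \<ge> 1"
    and "\<And>\<sigma>. \<sigma> \<in> falling_words n \<Longrightarrow> fundamental_cycle (sphere n \<sigma>) rees_le n (\<rho> \<sigma>)"
  shows "int_basis (reduced_homology (rees_poset n - {Bot, Top}) rees_le n) (falling_words n)
           (\<lambda>\<sigma>. homology_class (rees_poset n - {Bot, Top}) rees_le n (\<rho> \<sigma>))"
  unfolding proper_part_eq
proof (rule rees.int_basis_if_unitriangular[where m = "word_chain n" and W = "bar_weight n"])
  show "finite (falling_words n)" by (rule finite_falling_words)
next
  fix \<sigma> assume \<sigma>: "\<sigma> \<in> falling_words n"
  have cyc: "\<rho> \<sigma> \<in> cycles (sphere n \<sigma>) rees_le n"
    using assms(2)[OF \<sigma>] by (simp add: fundamental_cycle_def)
  then show "\<rho> \<sigma> \<in> cycles (proper_part n) rees_le n"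
    by (rule sphere_cycle_in_proper_part[OF assms(1) \<sigma>])
  show "\<bar>lookup (\<rho> \<sigma>) (word_chain n \<sigma>)\<bar> = 1"
    using fundamental_cycle_unit[OF assms(1) \<sigma> assms(2)[OF \<sigma>]] .
  fix \<tau> assume \<tau>: "\<tau> \<in> falling_words n" and "lookup (\<rho> \<sigma>) (word_chain n \<tau>) \<noteq> 0"
  then have "word_chain n \<tau> \<in> simplices (sphere n \<sigma>) rees_le n"
    using cyc by (auto simp: cycles_def chain_group_def in_keys_iff)
  then show "\<sigma> = \<tau> \<or> bar_weight n \<tau> < bar_weight n \<sigma>"
    by (rule falling_chain_in_sphere[OF assms(1) \<sigma> \<tau>])
next
  fix z assume "z \<in> cycles (proper_part n) rees_le n"
    "\<And>\<tau>. \<tau> \<in> falling_words n \<Longrightarrow> lookup z (word_chain n \<tau>) = 0"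
  then show "z = 0"
    by (rule cycle_zero_if_zero_on_falling_chains[OF assms(1)])
qed

end
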